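(* (i) Let $n\ge1$ and $p\ge2$ be integers. If $H\in\mathcal H$ and $h\in\mathcal H_n^{(p)}$, then $T_{n,p}(t(H,-))(h)=0$ if $|E(H)|\ne n$. (ii) Let $H\in\mathcal H_n$ and $h\in\mathcal H_n^{(p)}$. Then $T_{n,p}(t(H,-))(h)=|\mathrm{Surj}(H,\widetilde h)|/p^{|V(H)|}$. Therefore, $T_{n,p}(t(H,-))(h)>0$ for $H\in\mathcal H_n$ and $h\in\mathcal H_n^{(p)}$ if and only if there exists a surjective map from $H$ to $\widetilde h$. (iii) For fixed $p\ge2n$, the vectors $(T_{n,p}(t(H,-))(h))_{h\in\mathcal H_n^{(p)}}$, with $H$ varying over all of $\mathcal H_n$, are linearly independent. (iv) For all $n\ge1$, the vector space $LC_n\subset\prod_{p\ge2}X_{n,p}$ of linearly consistent vectors $(A_{n,p}(h))_{h\in\mathcal H_n^{(p)},\,p\ge2}$ has a basis given by $\{(T_{n,p}(t(H,-))(h))_{h\in\mathcal H_n^{(p)},\,p\ge2}:H\in\mathcal H_n\}$.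
   Context: $\mathcal W_{[0,1]}$ is the set of symmetric measurable functions $f:[0,1]^2\to[0,1]$ inside the vector space $\mathcal W$ of bounded symmetric measurable functions. Multigraphs are finite, undirected, without loops, possibly with multiple edges; an edge $e$ has endpoints $\{e_s,e_t\}$. A map of multigraphs $H\to G$ is a pair of maps $V(H)\to V(G)$, $E(H)\to E(G)$ compatible with endpoints; it is surjective if both maps are, and $\mathrm{Surj}(H,G)$ is the set of surjective maps. $\mathcal H_n$ is the set of isomorphism classes of multigraphs with $n$ edges and no isolated vertices, $\mathcal H=\bigcup_{n\ge0}\mathcal H_n$; $\mathcal H_n^{(p)}$ is the set of isomorphism classes of multigraphs with $n$ edges and $p$ vertices (isolated vertices allowed). A tilde denotes removing all isolated vertices. $X_{n,p}=\mathbb R^{\mathcal H_n^{(p)}}$. $t(H,f)=\int_{[0,1]^{V(H)}}\prod_{e\in E(H)}f(x_{e_s},x_{e_t})\prod_idx_i$, with $t(H,f)\equiv1$ if $H$ has no edges. For $1\le a<b\le p$, $e^p_{(a,b)}=e^p_{(b,a)}$ is the indicator function of $\left(\frac{a-1}p,\frac ap\right]\times\left(\frac{b-1}p,\frac bp\right]$ plus that of $\left(\frac{b-1}p,\frac bp\right]\times\left(\frac{a-1}p,\frac ap\right]$; $E_p=\{e^p_{(a,b)}:1\le a<b\le p\}$. For $x=(e^p_{(a_l,b_l)})_{l=1}^n\in E_p^n$, $\Gamma_{n,p}(x)$ is the multigraph with vertex set $\{1,\dots,p\}$ and $n$ edges, the $l$th joining $a_l$ and $b_l$; every class in $\mathcal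 H_n^{(p)}$ contains some $\Gamma_{n,p}(x)$. G\^ateaux derivatives at $f\in\mathcal W_{[0,1]}$ in directions $g_i$ with $f+\epsilon g_i\in\mathcal W_{[0,1]}$ for small $\epsilon\ge0$: $dF(f;g)=\lim_{\lambda\to0,\ f+\lambda g\in\mathcal W_{[0,1]}}\frac1\lambda(F(f+\lambda g)-F(f))$, and inductively $d^nF(f;g_1,\dots,g_n)=\lim_{\lambda\to0,\ f+\lambda g_n\in\mathcal W_{[0,1]}}\frac1\lambda(d^{n-1}F(f+\lambda g_n;g_1,\dots,g_{n-1})-d^{n-1}F(f;g_1,\dots,g_{n-1}))$. For $F=t(H,-)$, $n\ge1$, $p\ge2$, $h\in\mathcal H_n^{(p)}$: $T_{n,p}(F)(h)=d^nF(0;x_1,\dots,x_n)$ for any $x=(x_1,\dots,x_n)\in E_p^n$ with $\Gamma_{n,p}(x)$ in the class $h$ (independent of the choice of $x$). The matrix $\pi_{n,k}\in\mathbb Z_{\ge0}^{\mathcal H_n\times\mathcal H_n}$ ($k\ge1$): for $g,h\in\mathcal H_n$, choose any $p\ge2$ and $x=(e^p_{(a_l,b_l)})_{l=1}^n\in E_p^n$ with $\widetilde{\Gamma_{n,p}(x)}$ in the class $g$; $\pi_{n,k}(g,h)$ is the number of $(i_l,j_l)_{l=1}^n\in\{1,\dots,k\}^{2n}$ such that $\Gamma_{n,kp}\big((e^{kp}_{(k(a_l-1)+i_l,\,k(b_l-1)+j_l)})_{l=1}^n\big)$, after removing isolated vertices, is in the class $h$ (independent of choices). A vector $(A_{n,p})_{p\ge2}\in\prod_{p\ge2}X_{n,p}$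 is linearly consistent if $A_{n,p}(g)=\sum_{h\in\mathcal H_n^{(kp)}}\pi_{n,k}(\widetilde g,\widetilde h)A_{n,kp}(h)$ for all $p\ge2$, $k\ge1$, $g\in\mathcal H_n^{(p)}$; $LC_n$ is the space of such vectors. *)

theory Defs
  imports "HOL-Analysis.Analysis" "HOL-Library.Function_Algebras"
begin

instantiation "fun" :: (type, real_vector) real_vector
begin

definition scaleR_fun :: "real \<Rightarrow> ('a \<Rightarrow> 'b) \<Rightarrow> 'a \<Rightarrow> 'b" where
  "scaleR_fun c f = (\<lambda>x. c *\<^sub>R f x)"

instance
  by standard (auto simp: scaleR_fun_def fun_eq_iff scaleR_add_right scaleR_add_left)

end

section \<open>Multigraphs\<close>

text \<open>Edges are stored with an arbitrary orientation; maps and isomorphisms only see the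
  unordered pair of endpoints.\<close>

record ('v, 'e) multigraph =
  verts :: "'v set"
  edges :: "'e set"
  src :: "'e \<Rightarrow> 'v"
  tgt :: "'e \<Rightarrow> 'v"

definition ends :: "('v, 'e) multigraph \<Rightarrow> 'e \<Rightarrow> 'v set" where
  "ends G e = {src G e, tgt G e}"

definition is_multigraph :: "('v, 'e) multigraph \<Rightarrow> bool" where
  "is_multigraph G \<longleftrightarrow> finite (verts G) \<and> finite (edges G) \<and>
     (\<forall>e\<in>edges G. src G e \<in> verts G \<and> tgt G e \<in> verts G \<and> src G e \<noteq> tgt G e)"

definition multigraph_maps ::
  "('v, 'e) multigraph \<Rightarrow> ('w, 'f) multigraph \<Rightarrow> (('v \<Rightarrow> 'w) \<times> ('e \<Rightarrow> 'f)) set" where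
  "multigraph_maps H G = {(\<phi>, \<psi>). \<phi> \<in> verts H \<rightarrow>\<^sub>E verts G \<and> \<psi> \<in> edges H \<rightarrow>\<^sub>E edges G \<and>
     (\<forall>e\<in>edges H. ends G (\<psi> e) = \<phi> ` ends H e)}"

definition Surj ::
  "('v, 'e) multigraph \<Rightarrow> ('w, 'f) multigraph \<Rightarrow> (('v \<Rightarrow> 'w) \<times> ('e \<Rightarrow> 'f)) set" where
  "Surj H G = {(\<phi>, \<psi>) \<in> multigraph_maps H G. \<phi> ` verts H = verts G \<and> \<psi> ` edges H = edges G}"

definition non_isolated :: "('v, 'e) multigraph \<Rightarrow> 'v set" where
  "non_isolated G = {v \<in> verts G. \<exists>e\<in>edges G. v \<in> ends G e}"

definition strip :: "('v, 'e) multigraph \<Rightarrow> ('v, 'e) multigraph" where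
  "strip G = G\<lparr>verts := non_isolated G\<rparr>"

text \<open>Every finite multigraph is isomorphic to one with vertices and edges in \<open>nat\<close>, so
  isomorphism classes are formed inside that type.\<close>

type_synonym graph = "(nat, nat) multigraph"
type_synonym graph_class = "graph set"

definition graph_iso :: "(graph \<times> graph) set" where
  "graph_iso = {(G, H). is_multigraph G \<and> is_multigraph H \<and>
     (\<exists>(\<phi>, \<psi>) \<in> multigraph_maps G H.
        bij_betw \<phi> (verts G) (verts H) \<and> bij_betw \<psi> (edges G) (edges H))}"

definition \<H>\<^sub>n :: "nat \<Rightarrow> graph_class set" where
  "\<H>\<^sub>n n = {G. is_multigraph G \<and> card (edges G) = n \<and> non_isolated G = verts G} // graph_iso"

definition \<H> :: "graph_class set" where
  "\<H> = (\<Union>n. \<H>\<^sub>n n)"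

definition \<H>\<^sub>n\<^sub>p :: "nat \<Rightarrow> nat \<Rightarrow> graph_class set" where
  "\<H>\<^sub>n\<^sub>p n p = {G. is_multigraph G \<and> card (edges G) = n \<and> card (verts G) = p} // graph_iso"

definition strip_class :: "graph_class \<Rightarrow> graph_class" where
  "strip_class h = graph_iso `` (strip ` h)"

definition rep :: "graph_class \<Rightarrow> graph" where
  "rep C = (SOME G. G \<in> C)"

section \<open>Kernels, homomorphism densities and Gateaux derivatives\<close>

text \<open>Kernels are total functions of two real arguments, of which only the values on the unit
  square matter.\<close>

type_synonym kernel = "real \<Rightarrow> real \<Rightarrow> real"

definition \<W> :: "kernel set" where
  "\<W> = {f. (\<lambda>(u, v). f u v) \<in> borel_measurable (lebesgue_on ({0..1} \<times> {0..1})) \<and>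
     (\<exists>B. \<forall>u\<in>{0..1}. \<forall>v\<in>{0..1}. \<bar>f u v\<bar> \<le> B) \<and>
     (\<forall>u\<in>{0..1}. \<forall>v\<in>{0..1}. f u v = f v u)}"

definition \<W>\<^sub>0\<^sub>1 :: "kernel set" where
  "\<W>\<^sub>0\<^sub>1 = {f \<in> \<W>. \<forall>u\<in>{0..1}. \<forall>v\<in>{0..1}. 0 \<le> f u v \<and> f u v \<le> 1}"

text \<open>The product measure is completed since, for a Lebesgue measurable kernel, the integrand
  need not be measurable for the plain product sigma-algebra.\<close>

definition hom_density :: "('v, 'e) multigraph \<Rightarrow> kernel \<Rightarrow> real" where
  "hom_density H f =
     (LINT x | completion (Pi\<^sub>M (verts H) (\<lambda>_. lebesgue_on {0..1})).
        (\<Prod>e\<in>edges H. f (x (src H e)) (x (tgt H e))))"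

text \<open>\<open>gateaux n F f g\<close> is the derivative of order \<open>n\<close> of \<open>F\<close> at \<open>f\<close> in the directions
  \<open>g 1, \<dots>, g n\<close>.\<close>

primrec gateaux :: "nat \<Rightarrow> (kernel \<Rightarrow> real) \<Rightarrow> kernel \<Rightarrow> (nat \<Rightarrow> kernel) \<Rightarrow> real" where
  "gateaux 0 F f g = F f"
| "gateaux (Suc n) F f g =
     Lim (at 0 within {l. (\<lambda>u v. f u v + l * g (Suc n) u v) \<in> \<W>\<^sub>0\<^sub>1})
       (\<lambda>l. (1 / l) *
          (gateaux n F (\<lambda>u v. f u v + l * g (Suc n) u v) g - gateaux n F f g))"

section \<open>Step kernels and their multigraphs\<close>

fun step :: "nat \<Rightarrow> nat \<times> nat \<Rightarrow> kernel" where
  "step p (a, b) = (\<lambda>u v.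
     indicator {(real a - 1) / real p <.. real a / real p} u *
       indicator {(real b - 1) / real p <.. real b / real p} v +
     indicator {(real b - 1) / real p <.. real b / real p} u *
       indicator {(real a - 1) / real p <.. real a / real p} v)"

text \<open>\<open>step p\<close> is injective on the pairs \<open>(a, b)\<close> with \<open>1 \<le> a < b \<le> p\<close>, so tuples of step
  kernels are indexed by tuples of such pairs.\<close>

definition pair_tuples :: "nat \<Rightarrow> nat \<Rightarrow> (nat \<Rightarrow> nat \<times> nat) set" where
  "pair_tuples n p = {1..n} \<rightarrow>\<^sub>E {(a, b). 1 \<le> a \<and> a < b \<and> b \<le> p}"

definition \<Gamma> :: "nat \<Rightarrow> nat \<Rightarrow> (nat \<Rightarrow> nat \<times> nat) \<Rightarrow> graph" where
  "\<Gamma> n p x = \<lparr>verts = {1..p}, edges = {1..n}, src = (\<lambda>l. fst (x l)), tgt = (\<lambda>l. snd (x l))\<rparr>"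

text \<open>The value below is the one shared by all admissible tuples; likewise for \<open>refine_count\<close>.\<close>

definition T :: "nat \<Rightarrow> nat \<Rightarrow> (kernel \<Rightarrow> real) \<Rightarrow> graph_class \<Rightarrow> real" where
  "T n p F h = (THE r. \<forall>x\<in>pair_tuples n p. \<Gamma> n p x \<in> h \<longrightarrow>
     r = gateaux n F (\<lambda>_ _. 0) (\<lambda>l. step p (x l)))"

definition refine :: "nat \<Rightarrow> nat \<times> nat \<Rightarrow> nat \<times> nat \<Rightarrow> nat \<times> nat" where
  "refine k = (\<lambda>(a, b) (i, j). (k * (a - 1) + i, k * (b - 1) + j))"

text \<open>The matrix \<open>\<pi>\<^sub>n\<^sub>,\<^sub>k\<close>.\<close>

definition refine_count :: "nat \<Rightarrow> nat \<Rightarrow> graph_class \<Rightarrow> graph_class \<Rightarrow> nat" where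
  "refine_count n k g h = (THE c. \<forall>p\<ge>2. \<forall>x\<in>pair_tuples n p. strip (\<Gamma> n p x) \<in> g \<longrightarrow>
     c = card {ij \<in> {1..n} \<rightarrow>\<^sub>E {1..k} \<times> {1..k}.
           strip (\<Gamma> n (k * p) (\<lambda>l. refine k (x l) (ij l))) \<in> h})"

section \<open>Linear consistency\<close>

text \<open>The product of the spaces \<open>X\<^sub>n\<^sub>,\<^sub>p\<close> over \<open>p \<ge> 2\<close> is embedded in a function space by
  extending vectors by zero; likewise for \<open>X\<^sub>n\<^sub>,\<^sub>p\<close> itself in \<open>T_vec\<close>.\<close>

definition prod_X :: "nat \<Rightarrow> (nat \<Rightarrow> graph_class \<Rightarrow> real) set" where
  "prod_X n = {A. \<forall>p h. \<not> (p \<ge> 2 \<and> h \<in> \<H>\<^sub>n\<^sub>p n p) \<longrightarrow> A p h = 0}"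

definition LC :: "nat \<Rightarrow> (nat \<Rightarrow> graph_class \<Rightarrow> real) set" where
  "LC n = {A \<in> prod_X n. \<forall>p\<ge>2. \<forall>k\<ge>1. \<forall>g\<in>\<H>\<^sub>n\<^sub>p n p.
     A p g = (\<Sum>h\<in>\<H>\<^sub>n\<^sub>p n (k * p).
       real (refine_count n k (strip_class g) (strip_class h)) * A (k * p) h)}"

definition T_vec :: "nat \<Rightarrow> nat \<Rightarrow> graph_class \<Rightarrow> graph_class \<Rightarrow> real" where
  "T_vec n p C = (\<lambda>h. if h \<in> \<H>\<^sub>n\<^sub>p n p then T n p (hom_density (rep C)) h else 0)"

definition T_family :: "nat \<Rightarrow> graph_class \<Rightarrow> nat \<Rightarrow> graph_class \<Rightarrow> real" where
  "T_family n C = (\<lambda>p. if p \<ge> 2 then T_vec n p C else (\<lambda>_. 0))"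

end

theory Submission
  imports Defs
begin

text \<open>On kernels that are constant on the cells of the grid of mesh \<open>1 / p\<close>, the homomorphism
  density is a polynomial in the cell values, a sum over the maps from the vertices to the cells,
  and its Gateaux derivatives in step directions are partial derivatives. At zero only the
  monomials of degree exactly \<open>n\<close> survive, and they count surjections onto \<open>\<Gamma> n p x\<close>.

  A surjection between multigraphs with the same number of edges cannot increase the number of
  vertices, and is an isomorphism if it preserves it. So the matrix of numbers of surjections is
  triangular with nonzero diagonal, which gives the linear independence. The same
  argument applied to the maps from refined to unrefined multigraphs shows that a linearly
  consistent vector is determined by its component at \<open>p = 2 n\<close>, and there the system can be solved.\<close>

section \<open>Multigraph isomorphisms and surjections\<close>

text \<open>The limits are taken inside \<open>\<W>\<^sub>0\<^sub>1\<close>, and the base point 0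
  lies on its boundary; moreover each order of differentiation evaluates the previous one at nearby
  kernels. So the closed formula for derivatives is proved at all cellwise constant kernels of
  \<open>\<W>\<^sub>0\<^sub>1\<close>, together with the fact that enough step sizes are admissible
  for the limit to be unique.

  One identity governs refinement, \<open>sum_Surj_refine\<close>: over all k-fold refinements of a
  multigraph G, the numbers of surjections from H add up to k^|V(H)| times the number onto G. It
  makes the family of derivatives consistent. Since the surjection matrix is invertible, it also
  determines the refinement counts, so their independence of p and of the tuple follows without
  matching refinements one by one.

  The level 2 n occurs because n edges have at most 2 n endpoints: from there on every class in
  \<open>\<H>\<^sub>n n\<close> arises by stripping. An arbitrary level p is compared with it
  through the common refinement 2 n p.\<close>

lemma graph_isoI:
  assumes "is_multigraph G" "is_multigraph H"
    and "bij_betw \<phi> (verts G) (verts H)" "bij_betw \<psi> (edges G) (edges H)"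
    and "\<And>e. e \<in> edges G \<Longrightarrow> ends H (\<psi> e) = \<phi> ` ends G e"
  shows "(G, H) \<in> graph_iso"
proof -
  let ?\<phi> = "restrict \<phi> (verts G)" and ?\<psi> = "restrict \<psi> (edges G)"
  have "?\<phi> ` ends G e = \<phi> ` ends G e" if "e \<in> edges G" for e
    using assms(1) that by (auto simp: is_multigraph_def ends_def)
  then have "(?\<phi>, ?\<psi>) \<in> multigraph_maps G H"
    using assms by (auto simp: multigraph_maps_def bij_betw_def)
  moreover have "bij_betw ?\<phi> (verts G) (verts H)" "bij_betw ?\<psi> (edges G) (edges H)"
    using assms(3,4) by (simp_all cong: bij_betw_cong)
  ultimately show ?thesis
    using assms(1,2) unfolding graph_iso_def by blast
qed

lemma graph_isoE:
  assumes "(G, H) \<in> graph_iso"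
  obtains \<phi> \<psi> where "is_multigraph G" "is_multigraph H"
    "bij_betw \<phi> (verts G) (verts H)" "bij_betw \<psi> (edges G) (edges H)"
    "\<forall>e\<in>edges G. ends H (\<psi> e) = \<phi> ` ends G e"
proof -
  from assms obtain \<phi> \<psi> where "is_multigraph G" "is_multigraph H"
    "(\<phi>, \<psi>) \<in> multigraph_maps G H"
    "bij_betw \<phi> (verts G) (verts H)" "bij_betw \<psi> (edges G) (edges H)"
    unfolding graph_iso_def by blast
  then show ?thesis
    by (intro that[of \<phi> \<psi>]) (auto simp: multigraph_maps_def)
qed

lemma graph_iso_refl: "is_multigraph G \<Longrightarrow> (G, G) \<in> graph_iso"
  by (rule graph_isoI[of _ _ id id]) auto

lemma ends_subset_verts: "is_multigraph G \<Longrightarrow> e \<in> edges G \<Longrightarrow> ends G e \<subseteq> verts G"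
  by (auto simp: is_multigraph_def ends_def)

lemma card_ends: "is_multigraph G \<Longrightarrow> e \<in> edges G \<Longrightarrow> card (ends G e) = 2"
  by (auto simp: is_multigraph_def ends_def)

lemma finite_verts: "is_multigraph G \<Longrightarrow> finite (verts G)"
  and finite_edges: "is_multigraph G \<Longrightarrow> finite (edges G)"
  by (auto simp: is_multigraph_def)

lemma graph_iso_sym:
  assumes "(G, H) \<in> graph_iso" shows "(H, G) \<in> graph_iso"
proof -
  from assms obtain \<phi> \<psi> where G: "is_multigraph G" and H: "is_multigraph H"
    and b: "bij_betw \<phi> (verts G) (verts H)" "bij_betw \<psi> (edges G) (edges H)"
    and e: "\<forall>e\<in>edges G. ends H (\<psi> e) = \<phi> ` ends G e"
    by (rule graph_isoE)
  show ?thesis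
  proof (rule graph_isoI[OF H G bij_betw_inv_into[OF b(1)] bij_betw_inv_into[OF b(2)]])
    fix f assume f: "f \<in> edges H"
    let ?e = "inv_into (edges G) \<psi> f"
    have "?e \<in> edges G" "\<psi> ?e = f"
      using b(2) f by (auto simp: bij_betw_def inv_into_into f_inv_into_f)
    then show "ends G ?e = inv_into (verts G) \<phi> ` ends H f"
      using bspec[OF e, of ?e] ends_subset_verts[OF G, of ?e] b(1)
      by (auto simp: bij_betw_def image_image image_def subset_iff)
  qed
qed

lemma graph_iso_trans:
  assumes "(G, H) \<in> graph_iso" "(H, K) \<in> graph_iso" shows "(G, K) \<in> graph_iso"
proof -
  from assms(1) obtain \<phi> \<psi> where GH: "is_multigraph G" "is_multigraph H"
    "bij_betw \<phi> (verts G) (verts H)" "bij_betw \<psi> (edges G) (edges H)"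
    "\<forall>e\<in>edges G. ends H (\<psi> e) = \<phi> ` ends G e"
    by (metis graph_isoE)
  from assms(2) obtain \<phi>' \<psi>' where HK: "is_multigraph K"
    "bij_betw \<phi>' (verts H) (verts K)" "bij_betw \<psi>' (edges H) (edges K)"
    "\<forall>e\<in>edges H. ends K (\<psi>' e) = \<phi>' ` ends H e"
    by (metis graph_isoE)
  have "\<psi> e \<in> edges H" if "e \<in> edges G" for e
    using GH(4) that by (auto simp: bij_betw_def)
  then show ?thesis
    by (intro graph_isoI[OF GH(1) HK(1) bij_betw_trans[OF GH(3) HK(2)]
          bij_betw_trans[OF GH(4) HK(3)]]) (auto simp: GH(5) HK(4))
qed

lemma equiv_graph_iso: "equiv {G. is_multigraph G} graph_iso"
proof (rule equivI)
  show "graph_iso \<subseteq> {G. is_multigraph G} \<times> {G. is_multigraph G}"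
    by (auto simp: graph_iso_def)
  show "refl_on {G. is_multigraph G} graph_iso"
    using graph_iso_refl by (auto simp: refl_on_def)
  show "sym graph_iso" using graph_iso_sym by (rule symI)
  show "trans graph_iso" using graph_iso_trans by (rule transI)
qed

lemma graph_class_eq_iff:
  "is_multigraph G \<Longrightarrow> is_multigraph H \<Longrightarrow>
    graph_iso `` {G} = graph_iso `` {H} \<longleftrightarrow> (G, H) \<in> graph_iso"
  using eq_equiv_class_iff[OF equiv_graph_iso] by simp

lemma non_isolated_eq_Union: "is_multigraph G \<Longrightarrow> non_isolated G = \<Union> (ends G ` edges G)"
  using ends_subset_verts[of G] by (auto simp: non_isolated_def)

lemma non_isolated_bij:
  assumes "is_multigraph G" "is_multigraph H"
    and "bij_betw \<phi> (verts G) (verts H)" "bij_betw \<psi> (edges G) (edges H)"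
    and e: "\<forall>e\<in>edges G. ends H (\<psi> e) = \<phi> ` ends G e"
  shows "bij_betw \<phi> (non_isolated G) (non_isolated H)"
proof -
  note non_isolated_eq_Union[OF assms(1)] non_isolated_eq_Union[OF assms(2)]
  moreover have "edges H = \<psi> ` edges G"
    using assms(4) by (simp add: bij_betw_def)
  ultimately have "\<phi> ` non_isolated G = non_isolated H"
    using e by auto
  moreover have "inj_on \<phi> (non_isolated G)"
    using assms(3) by (auto simp: bij_betw_def non_isolated_def intro: inj_on_subset)
  ultimately show ?thesis
    by (simp add: bij_betw_def)
qed

lemma strip_simps [simp]:
  "verts (strip G) = non_isolated G" "edges (strip G) = edges G"
  "src (strip G) = src G" "tgt (strip G) = tgt G" "ends (strip G) = ends G"
  by (auto simp: strip_def ends_def)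

lemma non_isolated_strip [simp]: "non_isolated (strip G) = non_isolated G"
  by (auto simp: non_isolated_def)

lemma non_isolated_subset: "non_isolated G \<subseteq> verts G"
  by (auto simp: non_isolated_def)

lemma is_multigraph_strip:
  assumes "is_multigraph G" shows "is_multigraph (strip G)"
  using assms finite_subset[OF non_isolated_subset, of G]
  by (auto simp: is_multigraph_def non_isolated_def ends_def)



lemma graph_iso_strip:
  assumes "(G, H) \<in> graph_iso" shows "(strip G, strip H) \<in> graph_iso"
proof -
  from assms obtain \<phi> \<psi> where GH: "is_multigraph G" "is_multigraph H"
    "bij_betw \<phi> (verts G) (verts H)" "bij_betw \<psi> (edges G) (edges H)"
    "\<forall>e\<in>edges G. ends H (\<psi> e) = \<phi> ` ends G e"
    by (metis graph_isoE)
  from GH(1,2) have "is_multigraph (strip G)" "is_multigraph (strip H)"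
    by (simp_all add: is_multigraph_strip)
  then show ?thesis
    by (rule graph_isoI[of _ _ \<phi> \<psi>]) (use GH non_isolated_bij[OF GH] in simp_all)
qed

lemma graph_iso_card:
  assumes "(G, H) \<in> graph_iso"
  shows "card (verts G) = card (verts H)" "card (edges G) = card (edges H)"
  using assms by (metis bij_betw_same_card graph_isoE)+

text \<open>Equal vertex numbers leave equally many isolated vertices on both sides. No edge meets
  them, so any bijection between them extends the given isomorphism.\<close>

lemma graph_iso_of_strip:
  assumes G: "is_multigraph G" and H: "is_multigraph H"
    and "(strip G, strip H) \<in> graph_iso" and card: "card (verts G) = card (verts H)"
  shows "(G, H) \<in> graph_iso"
proof -
  from assms(3) obtain \<phi> \<psi> where
    \<phi>: "bij_betw \<phi> (non_isolated G) (non_isolated H)" and \<psi>: "bij_betw \<psi> (edges G) (edges H)" and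
    e: "\<forall>e\<in>edges G. ends H (\<psi> e) = \<phi> ` ends G e"
    by (rule graph_isoE) simp
  have fin: "finite (verts G)" "finite (verts H)"
    using G H by (auto intro: finite_verts)
  have "card (verts G - non_isolated G) = card (verts H - non_isolated H)"
    using card bij_betw_same_card[OF \<phi>] fin non_isolated_subset[of G] non_isolated_subset[of H]
    by (simp add: card_Diff_subset finite_subset)
  then obtain \<theta> where \<theta>: "bij_betw \<theta> (verts G - non_isolated G) (verts H - non_isolated H)"
    using fin by (meson finite_Diff finite_same_card_bij)
  let ?\<chi> = "\<lambda>v. if v \<in> non_isolated G then \<phi> v else \<theta> v"
  have "bij_betw ?\<chi> (non_isolated G \<union> (verts G - non_isolated G))
      (non_isolated H \<union> (verts H - non_isolated H))"
    using \<phi> \<theta> by (intro bij_betw_disjoint_Un) auto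
  then have \<chi>: "bij_betw ?\<chi> (verts G) (verts H)"
    using non_isolated_subset[of G] non_isolated_subset[of H] by (simp add: Un_absorb1)
  have "?\<chi> ` ends G f = \<phi> ` ends G f" if "f \<in> edges G" for f
    using that ends_subset_verts[OF G that] by (intro image_cong) (auto simp: non_isolated_def)
  then show ?thesis
    using e by (intro graph_isoI[OF G H \<chi> \<psi>]) simp
qed

section \<open>Surjections and their numbers\<close>

lemma finite_Surj:
  assumes "is_multigraph H" "is_multigraph G" shows "finite (Surj H G)"
proof (rule finite_subset)
  show "Surj H G \<subseteq> (verts H \<rightarrow>\<^sub>E verts G) \<times> (edges H \<rightarrow>\<^sub>E edges G)"
    by (auto simp: Surj_def multigraph_maps_def)
  show "finite ((verts H \<rightarrow>\<^sub>E verts G) \<times> (edges H \<rightarrow>\<^sub>E edges G))"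
    using assms by (intro finite_cartesian_product finite_PiE) (auto intro: finite_verts finite_edges)
qed

text \<open>Composing with the isomorphism is injective on surjections; the restrictions keep the
  composites extensional. Equality then comes from symmetry.\<close>

lemma card_Surj_le:
  assumes H: "is_multigraph H" and "(G, G') \<in> graph_iso"
  shows "card (Surj H G) \<le> card (Surj H G')"
proof -
  from assms(2) obtain \<phi> \<psi> where GG: "is_multigraph G" "is_multigraph G'"
    "bij_betw \<phi> (verts G) (verts G')" "bij_betw \<psi> (edges G) (edges G')"
    "\<forall>e\<in>edges G. ends G' (\<psi> e) = \<phi> ` ends G e"
    by (metis graph_isoE)
  let ?c = "\<lambda>(\<alpha>, \<beta>). (restrict (\<phi> \<circ> \<alpha>) (verts H), restrict (\<psi> \<circ> \<beta>) (edges H))"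
  show ?thesis
  proof (rule card_inj_on_le)
    show "inj_on ?c (Surj H G)"
    proof (rule inj_onI, clarify)
      fix \<alpha> \<beta> \<alpha>' \<beta>'
      assume S: "(\<alpha>, \<beta>) \<in> Surj H G" "(\<alpha>', \<beta>') \<in> Surj H G"
        and eq: "restrict (\<phi> \<circ> \<alpha>) (verts H) = restrict (\<phi> \<circ> \<alpha>') (verts H)"
          "restrict (\<psi> \<circ> \<beta>) (edges H) = restrict (\<psi> \<circ> \<beta>') (edges H)"
      have PiE: "\<alpha> \<in> verts H \<rightarrow>\<^sub>E verts G" "\<alpha>' \<in> verts H \<rightarrow>\<^sub>E verts G"
        "\<beta> \<in> edges H \<rightarrow>\<^sub>E edges G" "\<beta>' \<in> edges H \<rightarrow>\<^sub>E edges G"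
        using S by (auto simp: Surj_def multigraph_maps_def)
      have "\<alpha> v = \<alpha>' v" if "v \<in> verts H" for v
      proof (rule inj_onD[of \<phi> "verts G"])
        show "\<phi> (\<alpha> v) = \<phi> (\<alpha>' v)" using fun_cong[OF eq(1), of v] that by simp
      qed (use GG(3) PiE that in \<open>auto simp: bij_betw_def\<close>)
      moreover have "\<beta> v = \<beta>' v" if "v \<in> edges H" for v
      proof (rule inj_onD[of \<psi> "edges G"])
        show "\<psi> (\<beta> v) = \<psi> (\<beta>' v)" using fun_cong[OF eq(2), of v] that by simp
      qed (use GG(4) PiE that in \<open>auto simp: bij_betw_def\<close>)
      ultimately show "\<alpha> = \<alpha>' \<and> \<beta> = \<beta>'"
        using PiE by (auto intro: PiE_ext)
    qed
    show "?c ` Surj H G \<subseteq> Surj H G'"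
    proof clarify
      fix \<alpha> \<beta> assume S: "(\<alpha>, \<beta>) \<in> Surj H G"
      then have *: "\<alpha> \<in> verts H \<rightarrow>\<^sub>E verts G" "\<beta> \<in> edges H \<rightarrow>\<^sub>E edges G"
        "\<alpha> ` verts H = verts G" "\<beta> ` edges H = edges G"
        "\<And>e. e \<in> edges H \<Longrightarrow> ends G (\<beta> e) = \<alpha> ` ends H e"
        by (auto simp: Surj_def multigraph_maps_def)
      have "restrict (\<phi> \<circ> \<alpha>) (verts H) ` ends H e = \<phi> ` \<alpha> ` ends H e" if "e \<in> edges H" for e
        using ends_subset_verts[OF H that] by auto
      moreover have "\<beta> e \<in> edges G" if "e \<in> edges H" for e
        using *(2) that by auto
      moreover have "(\<phi> \<circ> \<alpha>) ` verts H = verts G'" "(\<psi> \<circ> \<beta>) ` edges H = edges G'"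
        using *(3,4) GG(3,4) by (simp_all only: image_comp[symmetric] bij_betw_def)
      moreover have "ends G' (\<psi> (\<beta> e)) = \<phi> ` \<alpha> ` ends H e" if "e \<in> edges H" for e
        using *(5) GG(5) PiE_mem[OF *(2) that] that by simp
      moreover have "restrict (\<phi> \<circ> \<alpha>) (verts H) ` verts H = verts G'"
        "restrict (\<psi> \<circ> \<beta>) (edges H) ` edges H = edges G'"
        using calculation(3,4) by simp_all
      ultimately show "(restrict (\<phi> \<circ> \<alpha>) (verts H), restrict (\<psi> \<circ> \<beta>) (edges H)) \<in> Surj H G'"
        unfolding Surj_def multigraph_maps_def by auto
    qed
    show "finite (Surj H G')" by (rule finite_Surj[OF H GG(2)])
  qed
qed

lemma card_Surj_cong:
  assumes "is_multigraph H" "(G, G') \<in> graph_iso"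
  shows "card (Surj H G) = card (Surj H G')"
  using card_Surj_le assms graph_iso_sym by (metis order_antisym)

lemma Surj_refl: "is_multigraph G \<Longrightarrow> Surj G G \<noteq> {}"
proof -
  assume "is_multigraph G"
  then have "(restrict id (verts G), restrict id (edges G)) \<in> Surj G G"
    using ends_subset_verts[of G] by (fastforce simp: Surj_def multigraph_maps_def image_iff)
  then show ?thesis by auto
qed



text \<open>Both components map a finite set onto one that is at least as large, hence are
  injective.\<close>

lemma Surj_imp_graph_iso:
  assumes H: "is_multigraph H" and G: "is_multigraph G"
    and "card (edges H) = card (edges G)" "card (verts H) \<le> card (verts G)" "Surj H G \<noteq> {}"
  shows "(H, G) \<in> graph_iso"
proof -
  from assms(5) obtain \<phi> \<psi> where s: "\<phi> ` verts H = verts G" "\<psi> ` edges H = edges G"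
    "\<And>e. e \<in> edges H \<Longrightarrow> ends G (\<psi> e) = \<phi> ` ends H e"
    by (fastforce simp: Surj_def multigraph_maps_def)
  have "inj_on \<phi> (verts H)"
    using s(1) assms(4) finite_verts[OF H] by (metis card_image_le eq_card_imp_inj_on order_antisym)
  moreover have "inj_on \<psi> (edges H)"
    using s(2) assms(3) finite_edges[OF H] by (metis eq_card_imp_inj_on)
  ultimately show ?thesis
    using s by (intro graph_isoI[OF H G, of \<phi> \<psi>]) (auto simp: bij_betw_def)
qed

section \<open>Isomorphism classes\<close>

lemma \<H>\<^sub>n\<^sub>pE:
  assumes "h \<in> \<H>\<^sub>n\<^sub>p n p"
  obtains G where "is_multigraph G" "card (edges G) = n" "card (verts G) = p" "h = graph_iso `` {G}"
  using assms by (auto simp: \<H>\<^sub>n\<^sub>p_def quotient_def)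

lemma \<H>\<^sub>n\<^sub>pI:
  "is_multigraph G \<Longrightarrow> card (edges G) = n \<Longrightarrow> card (verts G) = p \<Longrightarrow> graph_iso `` {G} \<in> \<H>\<^sub>n\<^sub>p n p"
  by (auto simp: \<H>\<^sub>n\<^sub>p_def quotient_def)

lemma \<H>\<^sub>nE:
  assumes "h \<in> \<H>\<^sub>n n"
  obtains G where "is_multigraph G" "card (edges G) = n" "non_isolated G = verts G"
    "h = graph_iso `` {G}"
  using assms by (auto simp: \<H>\<^sub>n_def quotient_def)

lemma \<H>\<^sub>nI:
  "is_multigraph G \<Longrightarrow> card (edges G) = n \<Longrightarrow> non_isolated G = verts G \<Longrightarrow> graph_iso `` {G} \<in> \<H>\<^sub>n n"
  by (auto simp: \<H>\<^sub>n_def quotient_def)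

lemma \<H>\<^sub>nD:
  assumes "C \<in> \<H>\<^sub>n n" "H \<in> C"
  shows "is_multigraph H" "card (edges H) = n" "non_isolated H = verts H" "C = graph_iso `` {H}"
proof -
  obtain G where G: "is_multigraph G" "card (edges G) = n" "non_isolated G = verts G"
    and C: "C = graph_iso `` {G}"
    using assms(1) by (rule \<H>\<^sub>nE)
  have iso: "(G, H) \<in> graph_iso" using assms(2) C by simp
  then show H: "is_multigraph H" by (rule graph_isoE)
  show "card (edges H) = n" using graph_iso_card[OF iso] G by simp
  show "C = graph_iso `` {H}" using iso G(1) H C by (simp add: graph_class_eq_iff)
  show "non_isolated H = verts H"
    using iso
  proof (rule graph_isoE)
    fix \<phi> \<psi> assume *: "is_multigraph G" "is_multigraph H" "bij_betw \<phi> (verts G) (verts H)"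
      "bij_betw \<psi> (edges G) (edges H)" "\<forall>e\<in>edges G. ends H (\<psi> e) = \<phi> ` ends G e"
    from non_isolated_bij[OF *] *(3) show ?thesis
      using G(3) by (simp add: bij_betw_def)
  qed
qed

lemma rep_in:
  assumes "C \<in> \<H>\<^sub>n n" shows "rep C \<in> C"
proof -
  obtain G where "is_multigraph G" "C = graph_iso `` {G}"
    using assms by (rule \<H>\<^sub>nE)
  then have "G \<in> C" using graph_iso_refl by simp
  then show ?thesis unfolding rep_def by (rule someI)
qed

lemma strip_class_graph_iso:
  assumes "is_multigraph G"
  shows "strip_class (graph_iso `` {G}) = graph_iso `` {strip G}"
  using assms graph_iso_refl graph_iso_strip graph_iso_trans unfolding strip_class_def by blast

lemma strip_class_in:
  assumes "h \<in> \<H>\<^sub>n\<^sub>p n p" shows "strip_class h \<in> \<H>\<^sub>n n"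
  using assms by (rule \<H>\<^sub>n\<^sub>pE) (simp add: strip_class_graph_iso \<H>\<^sub>nI is_multigraph_strip)

text \<open>Stripping forgets only how many isolated vertices there were, and \<open>p\<close>
  restores that number.\<close>

lemma inj_on_strip_class: "inj_on strip_class (\<H>\<^sub>n\<^sub>p n p)"
proof (rule inj_onI)
  fix g h assume "g \<in> \<H>\<^sub>n\<^sub>p n p" "h \<in> \<H>\<^sub>n\<^sub>p n p" "strip_class g = strip_class h"
  then show "g = h"
    by (elim \<H>\<^sub>n\<^sub>pE) (auto simp: strip_class_graph_iso graph_class_eq_iff is_multigraph_strip
        intro!: graph_iso_of_strip)
qed

text \<open>Every vertex is an endpoint and each edge has two of them. This is the origin of the
  bound \<open>2 * n\<close> on the levels.\<close>

lemma card_verts_le: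
  assumes "is_multigraph G" "non_isolated G = verts G"
  shows "card (verts G) \<le> 2 * card (edges G)"
proof -
  have "verts G = \<Union> (ends G ` edges G)"
    using assms non_isolated_eq_Union by metis
  then have "card (verts G) \<le> (\<Sum>e\<in>edges G. card (ends G e))"
    using card_UN_le[OF finite_edges[OF assms(1)]] by metis
  also have "\<dots> = 2 * card (edges G)"
    by (simp add: card_ends[OF assms(1)])
  finally show ?thesis .
qed

text \<open>For surjectivity, a multigraph without isolated vertices has at most
  \<open>2 * n\<close> vertices, so it can be padded with fresh naturals to exactly \<open>p\<close>
  vertices, and stripping removes the padding.\<close>

lemma strip_class_bij_betw:
  assumes "p \<ge> 2 * n"
  shows "bij_betw strip_class (\<H>\<^sub>n\<^sub>p n p) (\<H>\<^sub>n n)"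
proof -
  have "C \<in> strip_class ` \<H>\<^sub>n\<^sub>p n p" if "C \<in> \<H>\<^sub>n n" for C
    using that
  proof (rule \<H>\<^sub>nE)
    fix G assume G: "is_multigraph G" "card (edges G) = n" "non_isolated G = verts G"
      and C: "C = graph_iso `` {G}"
    have "card (verts G) \<le> p"
      using card_verts_le[OF G(1,3)] G(2) assms by simp
    moreover have "infinite (- verts G)"
      using finite_verts[OF G(1)] by simp
    then obtain W where W: "W \<subseteq> - verts G" "finite W" "card W = p - card (verts G)"
      using infinite_arbitrarily_large by metis
    ultimately have card: "card (verts G \<union> W) = p"
      using finite_verts[OF G(1)] by (subst card_Un_disjoint) auto
    define G' where "G' = G\<lparr>verts := verts G \<union> W\<rparr>"
    have G': "is_multigraph G'"
      using G(1) W(2) by (auto simp: is_multigraph_def G'_def)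
    have "non_isolated G' = verts G"
      using G(3) ends_subset_verts[OF G(1)] by (auto simp: non_isolated_def G'_def ends_def)
    then have "strip G' = G"
      by (simp add: strip_def G'_def)
    then have "C = strip_class (graph_iso `` {G'})"
      using C strip_class_graph_iso[OF G'] by simp
    moreover have "graph_iso `` {G'} \<in> \<H>\<^sub>n\<^sub>p n p"
      using G' card G(2) by (intro \<H>\<^sub>n\<^sub>pI) (simp_all add: G'_def)
    ultimately show ?thesis by blast
  qed
  then show ?thesis
    using inj_on_strip_class strip_class_in by (auto simp: bij_betw_def)
qed

text \<open>Unlike in \<open>pair_tuples\<close>, values outside \<open>{1..n}\<close> are unconstrained, since \<open>refine\<close>
  does not preserve extensionality.\<close>

definition valid_tuple :: "nat \<Rightarrow> nat \<Rightarrow> (nat \<Rightarrow> nat \<times> nat) \<Rightarrow> bool" where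
  "valid_tuple n p x \<longleftrightarrow> (\<forall>l\<in>{1..n}. 1 \<le> fst (x l) \<and> fst (x l) < snd (x l) \<and> snd (x l) \<le> p)"

lemma valid_pair_tuples: "x \<in> pair_tuples n p \<Longrightarrow> valid_tuple n p x"
  by (simp add: pair_tuples_def valid_tuple_def PiE_iff case_prod_beta)

lemma \<Gamma>_simps [simp]:
  "verts (\<Gamma> n p x) = {1..p}" "edges (\<Gamma> n p x) = {1..n}"
  "ends (\<Gamma> n p x) l = {fst (x l), snd (x l)}"
  by (auto simp: \<Gamma>_def ends_def)

lemma is_multigraph_\<Gamma>: "valid_tuple n p x \<Longrightarrow> is_multigraph (\<Gamma> n p x)"
proof -
  assume x: "valid_tuple n p x"
  have "fst (x l) \<in> {1..p} \<and> snd (x l) \<in> {1..p} \<and> fst (x l) \<noteq> snd (x l)" if "l \<in> {1..n}" for l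
    using bspec[OF x[unfolded valid_tuple_def] that] by simp
  then show ?thesis
    by (simp add: is_multigraph_def \<Gamma>_def)
qed

lemma \<Gamma>_in_\<H>\<^sub>n\<^sub>p: "valid_tuple n p x \<Longrightarrow> graph_iso `` {\<Gamma> n p x} \<in> \<H>\<^sub>n\<^sub>p n p"
  by (intro \<H>\<^sub>n\<^sub>pI is_multigraph_\<Gamma>) auto

lemma ex_\<Gamma>:
  assumes "h \<in> \<H>\<^sub>n\<^sub>p n p"
  obtains x where "x \<in> pair_tuples n p" "h = graph_iso `` {\<Gamma> n p x}"
proof -
  obtain G where G: "is_multigraph G" "card (edges G) = n" "card (verts G) = p"
    and h: "h = graph_iso `` {G}"
    using assms by (rule \<H>\<^sub>n\<^sub>pE)
  obtain \<alpha> where \<alpha>: "bij_betw \<alpha> (verts G) {1..p}"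
    using finite_verts[OF G(1)] G(3) by (metis card_atLeastAtMost diff_Suc_1 finite_atLeastAtMost finite_same_card_bij)
  obtain \<beta> where \<beta>: "bij_betw \<beta> {1..n} (edges G)"
    using finite_edges[OF G(1)] G(2) by (metis card_atLeastAtMost diff_Suc_1 finite_atLeastAtMost finite_same_card_bij)
  \<comment> \<open>Sorting the two endpoints gives the increasing pairs required by
    \<open>pair_tuples\<close>.\<close>
  define x where "x = (\<lambda>l\<in>{1..n}. (Min (\<alpha> ` ends G (\<beta> l)), Max (\<alpha> ` ends G (\<beta> l))))"
  have ex: "\<exists>a b. \<alpha> ` ends G (\<beta> l) = {a, b} \<and> 1 \<le> a \<and> a < b \<and> b \<le> p \<and> x l = (a, b)"
    if l: "l \<in> {1..n}" for l
  proof -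
    let ?e = "\<beta> l"
    have "?e \<in> edges G" using \<beta> l by (auto simp: bij_betw_def)
    then have e: "src G ?e \<in> verts G" "tgt G ?e \<in> verts G" "src G ?e \<noteq> tgt G ?e"
      using G(1) by (auto simp: is_multigraph_def)
    then have ne: "\<alpha> (src G ?e) \<noteq> \<alpha> (tgt G ?e)"
      using \<alpha> by (auto simp: bij_betw_def inj_on_def)
    have "\<alpha> (src G ?e) \<in> {1..p}" "\<alpha> (tgt G ?e) \<in> {1..p}"
      using \<alpha> e by (auto simp: bij_betw_def)
    then show ?thesis
      using ne l by (cases "\<alpha> (src G ?e) < \<alpha> (tgt G ?e)") (auto simp: x_def ends_def insert_commute)
  qed
  have "x \<in> pair_tuples n p"
    unfolding pair_tuples_def
  proof (rule PiE_I)
    show "x l \<in> {(a, b). 1 \<le> a \<and> a < b \<and> b \<le> p}" if "l \<in> {1..n}" for l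
      using ex[OF that] by auto
  qed (auto simp: x_def)
  moreover have "(\<Gamma> n p x, G) \<in> graph_iso"
  proof (rule graph_iso_sym, rule graph_isoI[OF G(1)])
    show "is_multigraph (\<Gamma> n p x)"
      using calculation by (intro is_multigraph_\<Gamma> valid_pair_tuples)
    show "bij_betw \<alpha> (verts G) (verts (\<Gamma> n p x))"
      using \<alpha> by simp
    show "bij_betw (inv_into {1..n} \<beta>) (edges G) (edges (\<Gamma> n p x))"
      using bij_betw_inv_into[OF \<beta>] by simp
    fix e assume "e \<in> edges G"
    then obtain l where "l \<in> {1..n}" "\<beta> l = e"
      using \<beta> by (metis bij_betw_imp_surj_on imageE)
    then show "ends (\<Gamma> n p x) (inv_into {1..n} \<beta> e) = \<alpha> ` ends G e"
      using ex[of l] \<beta> by (force simp: bij_betw_def)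
  qed
  ultimately show ?thesis
    using that h G(1) by (metis graph_class_eq_iff graph_iso_sym is_multigraph_\<Gamma> valid_pair_tuples)
qed

lemma finite_\<H>\<^sub>n\<^sub>p: "finite (\<H>\<^sub>n\<^sub>p n p)"
proof (rule finite_surj)
  show "\<H>\<^sub>n\<^sub>p n p \<subseteq> (\<lambda>x. graph_iso `` {\<Gamma> n p x}) ` pair_tuples n p"
  proof
    fix h assume "h \<in> \<H>\<^sub>n\<^sub>p n p"
    then obtain x where "x \<in> pair_tuples n p" "h = graph_iso `` {\<Gamma> n p x}"
      by (rule ex_\<Gamma>)
    then show "h \<in> (\<lambda>x. graph_iso `` {\<Gamma> n p x}) ` pair_tuples n p"
      by blast
  qed
  have "{(a, b). 1 \<le> a \<and> a < b \<and> b \<le> p} \<subseteq> {1..p} \<times> {1..p}" by auto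
  then show "finite (pair_tuples n p)"
    unfolding pair_tuples_def by (intro finite_PiE) (auto intro: finite_subset)
qed

lemma finite_\<H>\<^sub>n: "finite (\<H>\<^sub>n n)"
  using bij_betw_finite[OF strip_class_bij_betw[of n "2 * n"]] finite_\<H>\<^sub>n\<^sub>p by simp

section \<open>Derivatives of homomorphism densities\<close>

text \<open>The mixed partial derivative of \<open>\<Prod>e\<in>S. f e\<close>, as a function of \<open>f\<close>, in the directions
  \<open>g 1, \<dots>, g k\<close>.\<close>

primrec prod_deriv :: "nat \<Rightarrow> (nat \<Rightarrow> 'e \<Rightarrow> real) \<Rightarrow> 'e set \<Rightarrow> ('e \<Rightarrow> real) \<Rightarrow> real" where
  "prod_deriv 0 g S f = (\<Prod>e\<in>S. f e)"
| "prod_deriv (Suc k) g S f = (\<Sum>e\<in>S. g (Suc k) e * prod_deriv k g (S - {e}) f)"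

lemma has_field_derivative_prod_deriv:
  assumes "finite S"
  shows "((\<lambda>l. prod_deriv k g S (\<lambda>e. f e + l * v e)) has_field_derivative
           (\<Sum>e\<in>S. v e * prod_deriv k g (S - {e}) f)) (at 0)"
  using assms
proof (induction k arbitrary: S)
  case 0
  have "((\<lambda>l. f e + l * v e) has_field_derivative v e) (at 0)" for e
    by (auto intro!: derivative_eq_intros)
  from has_field_derivative_prod[of S "\<lambda>e l. f e + l * v e" v 0, OF this] show ?case
    by simp
next
  case (Suc k)
  have "((\<lambda>l. \<Sum>e\<in>S. g (Suc k) e * prod_deriv k g (S - {e}) (\<lambda>e. f e + l * v e))
      has_field_derivative
      (\<Sum>e\<in>S. g (Suc k) e * (\<Sum>e'\<in>S - {e}. v e' * prod_deriv k g (S - {e} - {e'}) f))) (at 0)"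
    using Suc by (intro DERIV_sum DERIV_cmult) auto
  \<comment> \<open>The induction removes the edge differentiated along \<open>v\<close> last, the
    claim removes it first. Both are the same sum over ordered pairs of distinct edges.\<close>
  moreover have "(\<Sum>e\<in>S. g (Suc k) e * (\<Sum>e'\<in>S - {e}. v e' * prod_deriv k g (S - {e} - {e'}) f)) =
      (\<Sum>e\<in>S. v e * (\<Sum>e'\<in>S - {e}. g (Suc k) e' * prod_deriv k g (S - {e} - {e'}) f))"
  proof -
    have "(\<Sum>e\<in>S. g (Suc k) e * (\<Sum>e'\<in>S - {e}. v e' * prod_deriv k g (S - {e} - {e'}) f)) =
        (\<Sum>e\<in>S. \<Sum>e'\<in>{e'\<in>S. e \<noteq> e'}. g (Suc k) e * (v e' * prod_deriv k g (S - {e} - {e'}) f))"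
      by (auto simp: sum_distrib_left intro!: sum.cong)
    also have "\<dots> =
        (\<Sum>e'\<in>S. \<Sum>e\<in>{e\<in>S. e \<noteq> e'}. g (Suc k) e * (v e' * prod_deriv k g (S - {e} - {e'}) f))"
      using Suc.prems by (intro sum.swap_restrict)
    also have "\<dots> = (\<Sum>e\<in>S. v e * (\<Sum>e'\<in>S - {e}. g (Suc k) e' * prod_deriv k g (S - {e} - {e'}) f))"
      by (auto simp: sum_distrib_left Diff_insert2[symmetric] insert_commute mult_ac
          intro!: sum.cong arg_cong2[where f="(*)"] arg_cong[where f="\<lambda>X. prod_deriv k g X f"])
    finally show ?thesis .
  qed
  ultimately show ?case by simp
qed

text \<open>Such a map records which direction differentiates which edge factor; extensionality
  makes the set finite and the terms of the product rule correspond to its elements.\<close>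

definition bijections :: "'e set \<Rightarrow> nat \<Rightarrow> ('e \<Rightarrow> nat) set" where
  "bijections S n = {\<psi> \<in> S \<rightarrow>\<^sub>E {1..n}. bij_betw \<psi> S {1..n}}"

lemma finite_bijections: "finite S \<Longrightarrow> finite (bijections S n)"
  unfolding bijections_def by (rule finite_subset[of _ "S \<rightarrow>\<^sub>E {1..n}"]) (auto intro: finite_PiE)

lemma bijections_empty: "card S \<noteq> n \<Longrightarrow> bijections S n = {}"
  unfolding bijections_def using bij_betw_same_card by fastforce

text \<open>Together with \<open>bijections_remove\<close> this splits a bijection at the edge that
  receives the last direction, which mirrors the recursion of \<open>prod_deriv\<close>.\<close>

lemma bijections_insert:
  assumes "e \<in> S" "\<eta> \<in> bijections (S - {e}) n"
  shows "\<eta>(e := Suc n) \<in> bijections S (Suc n)"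
proof -
  have "bij_betw (\<eta>(e := Suc n)) (S - {e}) {1..n}"
    using assms(2) by (simp add: bijections_def bij_betw_def inj_on_def)
  moreover have "bij_betw (\<eta>(e := Suc n)) {e} {Suc n}"
    by simp
  ultimately have "bij_betw (\<eta>(e := Suc n)) ((S - {e}) \<union> {e}) ({1..n} \<union> {Suc n})"
    by (rule bij_betw_combine) auto
  moreover have "(S - {e}) \<union> {e} = S" "{1..n} \<union> {Suc n} = {1..Suc n}"
    using assms(1) by auto
  ultimately have bij: "bij_betw (\<eta>(e := Suc n)) S {1..Suc n}"
    by simp
  moreover have "\<eta>(e := Suc n) \<in> extensional S"
    using assms by (auto simp: bijections_def PiE_def extensional_def)
  ultimately show ?thesis
    using bij_betw_imp_funcset[OF bij] by (simp add: bijections_def PiE_def)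
qed

lemma bijections_remove:
  assumes "\<psi> \<in> bijections S (Suc n)"
  defines "e \<equiv> inv_into S \<psi> (Suc n)"
  shows "e \<in> S" "\<psi> e = Suc n" "restrict \<psi> (S - {e}) \<in> bijections (S - {e}) n"
proof -
  have bij: "bij_betw \<psi> S {1..Suc n}"
    using assms(1) by (simp add: bijections_def)
  then have "Suc n \<in> \<psi> ` S"
    by (simp add: bij_betw_def)
  then show e: "e \<in> S" "\<psi> e = Suc n"
    unfolding e_def by (auto intro: inv_into_into f_inv_into_f)
  have "bij_betw \<psi> (S - {e}) ({1..Suc n} - {\<psi> e})"
    using bij e(1) by (auto simp: bij_betw_def inj_on_def)
  moreover have "{1..Suc n} - {\<psi> e} = {1..n}"
    using e(2) by auto
  ultimately have "bij_betw \<psi> (S - {e}) {1..n}"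
    by simp
  then have "bij_betw (restrict \<psi> (S - {e})) (S - {e}) {1..n}"
    by (subst bij_betw_cong[of _ _ \<psi>]) auto
  then show "restrict \<psi> (S - {e}) \<in> bijections (S - {e}) n"
    by (auto simp: bijections_def bij_betw_def)
qed

text \<open>An undifferentiated factor vanishes at zero, and a factor linear in \<open>f\<close> can
  be differentiated only once. What survives are the assignments that give each edge exactly one
  direction and use each direction once.\<close>

lemma prod_deriv_zero:
  assumes "finite S"
  shows "prod_deriv n g S (\<lambda>_. 0) = (\<Sum>\<psi>\<in>bijections S n. \<Prod>e\<in>S. g (\<psi> e) e)"
  using assms
proof (induction n arbitrary: S)
  case 0
  show ?case
  proof (cases "S = {}")
    case True
    then have "bijections S 0 = {\<lambda>_. undefined}"
      by (auto simp: bijections_def bij_betw_def)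
    then show ?thesis using True by simp
  next
    case False
    then have "bijections S 0 = {}"
      by (auto simp: bijections_def bij_betw_def)
    then show ?thesis
      using False 0 by (simp add: card_gt_0_iff)
  qed
next
  case (Suc n)
  let ?F = "\<lambda>S \<psi>. \<Prod>e\<in>S. g (\<psi> e) e"
  have "prod_deriv (Suc n) g S (\<lambda>_. 0) =
      (\<Sum>e\<in>S. \<Sum>\<eta>\<in>bijections (S - {e}) n. g (Suc n) e * ?F (S - {e}) \<eta>)"
    using Suc by (simp add: sum_distrib_left)
  also have "\<dots> = (\<Sum>(e, \<eta>)\<in>Sigma S (\<lambda>e. bijections (S - {e}) n). g (Suc n) e * ?F (S - {e}) \<eta>)"
    using Suc.prems by (intro sum.Sigma) (auto intro: finite_bijections)
  also have "\<dots> = (\<Sum>\<psi>\<in>bijections S (Suc n). ?F S \<psi>)"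
  proof (rule sum.reindex_bij_witness[where
        i = "\<lambda>\<psi>. let e = inv_into S \<psi> (Suc n) in (e, restrict \<psi> (S - {e}))" and
        j = "\<lambda>(e, \<eta>). \<eta>(e := Suc n)"])
    fix \<psi> assume \<psi>: "\<psi> \<in> bijections S (Suc n)"
    note r = bijections_remove[OF \<psi>]
    show "(let e = inv_into S \<psi> (Suc n) in (e, restrict \<psi> (S - {e})))
        \<in> Sigma S (\<lambda>e. bijections (S - {e}) n)"
      using r by (simp add: Let_def)
    have "\<psi> \<in> extensional S" using \<psi> by (auto simp: bijections_def PiE_def)
    then show "(case let e = inv_into S \<psi> (Suc n) in (e, restrict \<psi> (S - {e})) of
        (e, \<eta>) \<Rightarrow> \<eta>(e := Suc n)) = \<psi>"
      using r(1,2) by (auto simp: Let_def fun_eq_iff restrict_def extensional_def)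
  next
    fix a assume "a \<in> Sigma S (\<lambda>e. bijections (S - {e}) n)"
    then obtain e \<eta> where a: "a = (e, \<eta>)" "e \<in> S" "\<eta> \<in> bijections (S - {e}) n"
      by auto
    note b = bijections_insert[OF a(2,3)]
    show "(case a of (e, \<eta>) \<Rightarrow> \<eta>(e := Suc n)) \<in> bijections S (Suc n)"
      using b a(1) by simp
    have "inj_on (\<eta>(e := Suc n)) S"
      using b by (simp add: bijections_def bij_betw_def)
    from inv_into_f_f[OF this a(2)] have e: "inv_into S (\<eta>(e := Suc n)) (Suc n) = e"
      by simp
    have "\<eta> \<in> extensional (S - {e})" using a(3) by (auto simp: bijections_def PiE_def)
    then have "restrict (\<eta>(e := Suc n)) (S - {e}) = \<eta>"
      by (auto simp: fun_eq_iff restrict_def extensional_def)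
    then show "(let e = inv_into S (case a of (e, \<eta>) \<Rightarrow> \<eta>(e := Suc n)) (Suc n)
        in (e, restrict (case a of (e, \<eta>) \<Rightarrow> \<eta>(e := Suc n)) (S - {e}))) = a"
      using e a(1) by (simp add: Let_def)
    show "?F S (case a of (e, \<eta>) \<Rightarrow> \<eta>(e := Suc n)) =
        (case a of (e, \<eta>) \<Rightarrow> g (Suc n) e * ?F (S - {e}) \<eta>)"
      using Suc.prems a(1,2) by (simp add: prod.remove)
  qed
  finally show ?case .
qed

section \<open>Grid cells and kernels constant on them\<close>

definition cell :: "nat \<Rightarrow> nat \<Rightarrow> real set" where
  "cell p a = {(real a - 1) / real p <.. real a / real p}"

lemma step_eq:
  "step p (a, b) u v = indicator (cell p a) u * indicator (cell p b) v +
    indicator (cell p b) u * indicator (cell p a) v"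
  by (simp add: cell_def)

declare step.simps [simp del]

lemma cell_unique:
  assumes "u \<in> cell p a" "u \<in> cell p b" "p > 0" shows "a = b"
proof -
  have "real a - 1 < real p * u" "real p * u \<le> real a" "real b - 1 < real p * u" "real p * u \<le> real b"
    using assms by (auto simp: cell_def field_simps)
  then show ?thesis by linarith
qed

lemma endpoint_in_cell: "p > 0 \<Longrightarrow> real c / real p \<in> cell p a \<longleftrightarrow> c = a"
  using cell_unique[of "real c / real p" p c a] by (auto simp: cell_def field_simps)

lemma zero_notin_cell: "a \<ge> 1 \<Longrightarrow> 0 \<notin> cell p a"
  by (auto simp: cell_def divide_less_0_iff)

lemma cell_subset: "a \<in> {1..p} \<Longrightarrow> cell p a \<subseteq> {0..1}"
proof
  fix u assume a: "a \<in> {1..p}" and u: "u \<in> cell p a"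
  have "0 \<le> (real a - 1) / real p" "real a / real p \<le> 1"
    using a by auto
  then show "u \<in> {0..1}" using u unfolding cell_def by auto
qed

lemma cell_cover:
  assumes "u \<in> {0..1}" "u \<noteq> 0" "p > 0" obtains a where "a \<in> {1..p}" "u \<in> cell p a"
proof -
  \<comment> \<open>The cells are closed on the right, so the index is a ceiling; the point 0
    belongs to none of them.\<close>
  let ?a = "nat \<lceil>real p * u\<rceil>"
  have pos: "real p * u > 0" using assms by simp
  then have "\<lceil>real p * u\<rceil> \<ge> 1" by linarith
  moreover have "real p * u \<le> real p" using assms by (simp add: mult_left_le)
  then have "\<lceil>real p * u\<rceil> \<le> int p" by linarith
  ultimately have "?a \<in> {1..p}" by (simp add: le_nat_iff nat_le_iff)
  moreover have "real ?a - 1 < real p * u" "real p * u \<le> real ?a"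
    using pos by linarith+
  then have "u \<in> cell p ?a"
    using assms(3) by (simp add: cell_def field_simps)
  ultimately show ?thesis by (rule that)
qed

text \<open>The right endpoint \<open>a / p\<close> lies in \<open>cell p a\<close> and serves as its sample point.\<close>

definition cellwise :: "nat \<Rightarrow> kernel \<Rightarrow> bool" where
  "cellwise p f \<longleftrightarrow> (\<forall>u v. u = 0 \<or> v = 0 \<longrightarrow> f u v = 0) \<and>
     (\<forall>a\<in>{1..p}. \<forall>b\<in>{1..p}. \<forall>u\<in>cell p a. \<forall>v\<in>cell p b. f u v = f (real a / real p) (real b / real p))"

lemma cellwise_add: "cellwise p f \<Longrightarrow> cellwise p g \<Longrightarrow> cellwise p (\<lambda>u v. f u v + l * g u v)"
  by (simp add: cellwise_def)

lemma cellwise_step: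
  assumes "1 \<le> a" "1 \<le> b" "p > 0" shows "cellwise p (step p (a, b))"
proof -
  have "indicator (cell p c) u = (indicator (cell p c) (real d / real p) :: real)"
    if "u \<in> cell p d" for c d u
    using that cell_unique[OF _ that, of c] endpoint_in_cell[of p d c] assms(3)
    by (auto simp: indicator_def)
  then show ?thesis
    using zero_notin_cell[OF assms(1)] zero_notin_cell[OF assms(2)]
    unfolding cellwise_def step_eq by simp
qed

text \<open>With \<open>a < b\<close> the two products in a step kernel are never both 1, so the
  value is an indicator of the unordered pair.\<close>

lemma step_endpoint:
  assumes "a < b" "p > 0"
  shows "step p (a, b) (real c / real p) (real d / real p) = of_bool ({c, d} = {a, b})"
  using assms by (auto simp: step_eq indicator_def endpoint_in_cell doubleton_eq_iff)

section \<open>Admissible directions\<close>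

lemma \<W>_add:
  assumes "f \<in> \<W>" "g \<in> \<W>" shows "(\<lambda>u v. f u v + l * g u v) \<in> \<W>"
proof -
  let ?M = "lebesgue_on ({0..1::real} \<times> {0..1::real})"
  have "(\<lambda>z. (case z of (u, v) \<Rightarrow> f u v) + l * (case z of (u, v) \<Rightarrow> g u v)) \<in> borel_measurable ?M"
    using assms by (intro borel_measurable_add borel_measurable_times borel_measurable_const)
      (auto simp: \<W>_def)
  then have "(\<lambda>(u, v). f u v + l * g u v) \<in> borel_measurable ?M"
    by (simp add: case_prod_beta)
  moreover obtain B C where BC: "\<forall>u\<in>{0..1}. \<forall>v\<in>{0..1}. \<bar>f u v\<bar> \<le> B" "\<forall>u\<in>{0..1}. \<forall>v\<in>{0..1}. \<bar>g u v\<bar> \<le> C"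
    using assms unfolding \<W>_def by blast
  have "\<bar>f u v + l * g u v\<bar> \<le> B + \<bar>l\<bar> * C" if "u \<in> {0..1}" "v \<in> {0..1}" for u v
    using BC that by (intro order_trans[OF abs_triangle_ineq] add_mono)
      (auto simp: abs_mult intro: mult_left_mono)
  moreover have "\<forall>u\<in>{0..1}. \<forall>v\<in>{0..1}. f u v + l * g u v = f v u + l * g v u"
    using assms by (simp add: \<W>_def)
  ultimately show ?thesis unfolding \<W>_def by blast
qed

lemma step_in_\<W>: "step p (a, b) \<in> \<W>"
proof -
  have "(\<lambda>z::real \<times> real. step p (a, b) (fst z) (snd z)) \<in> borel_measurable (borel \<Otimes>\<^sub>M borel)"
    unfolding step_eq cell_def by measurable
  then have "(\<lambda>z::real \<times> real. step p (a, b) (fst z) (snd z)) \<in> borel_measurable borel"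
    by (simp add: borel_prod)
  then have "(\<lambda>(u, v). step p (a, b) u v) \<in> borel_measurable (lebesgue_on ({0..1} \<times> {0..1}))"
    by (intro measurable_restrict_space1 borel_measurable_if_I measurable_completion)
      (simp add: case_prod_beta)
  \<comment> \<open>The bound is 2 and not 1 because \<open>a = b\<close> is allowed here, where
    both products overlap.\<close>
  moreover have "\<bar>step p (a, b) u v\<bar> \<le> 2" for u v
    by (simp add: step_eq indicator_def)
  moreover have "step p (a, b) u v = step p (a, b) v u" for u v
    by (simp add: step_eq)
  ultimately show ?thesis unfolding \<W>_def by blast
qed

lemma zero_in_\<W>\<^sub>0\<^sub>1: "(\<lambda>_ _. 0) \<in> \<W>\<^sub>0\<^sub>1"
  by (auto simp: \<W>\<^sub>0\<^sub>1_def \<W>_def)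

text \<open>A limit along a trivial filter would carry no information. The kernel has a constant
  value \<open>c\<close> on the two blocks supporting the step kernel, so every step size in
  [-c, 1 - c] is admissible, even when \<open>c\<close> is 0 or 1 and only one sign is
  possible.\<close>

lemma at_within_directions_nontrivial:
  assumes f: "f \<in> \<W>\<^sub>0\<^sub>1" "cellwise p f" and ab: "1 \<le> a" "a < b" "b \<le> p"
  shows "at 0 within {l. (\<lambda>u v. f u v + l * step p (a, b) u v) \<in> \<W>\<^sub>0\<^sub>1} \<noteq> bot"
proof -
  let ?D = "{l. (\<lambda>u v. f u v + l * step p (a, b) u v) \<in> \<W>\<^sub>0\<^sub>1}"
  define c where "c = f (real a / real p) (real b / real p)"
  have p: "p > 0" using ab by simp
  have f01: "0 \<le> f u v \<and> f u v \<le> 1" "f u v = f v u" if "u \<in> {0..1}" "v \<in> {0..1}" for u v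
    using f that by (auto simp: \<W>\<^sub>0\<^sub>1_def \<W>_def)
  have unit: "real a / real p \<in> {0..1}" "real b / real p \<in> {0..1}"
    using ab by auto
  then have c: "0 \<le> c" "c \<le> 1" using f01 by (auto simp: c_def)
  have inD: "l \<in> ?D" if l: "- c \<le> l" "l \<le> 1 - c" for l
  proof -
    have "(step p (a, b) u v = 0 \<or> step p (a, b) u v = 1 \<and> f u v = c)"
      if uv: "u \<in> {0..1}" "v \<in> {0..1}" for u v
    proof -
      have "\<not> (u \<in> cell p a \<and> u \<in> cell p b)" using cell_unique[of u p a b] p ab by auto
      moreover have "f u v = c" if "u \<in> cell p a" "v \<in> cell p b"
        using f(2) that ab unfolding cellwise_def c_def by auto
      moreover have "f u v = c" if "u \<in> cell p b" "v \<in> cell p a"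
      proof -
        have "f u v = f (real b / real p) (real a / real p)"
          using f(2) that ab unfolding cellwise_def by auto
        then show ?thesis using f01(2)[OF unit] c_def by simp
      qed
      ultimately show ?thesis by (auto simp: step_eq indicator_def)
    qed
    then have "0 \<le> f u v + l * step p (a, b) u v \<and> f u v + l * step p (a, b) u v \<le> 1"
      if "u \<in> {0..1}" "v \<in> {0..1}" for u v
      using f01(1)[OF that] l that by fastforce
    moreover have "(\<lambda>u v. f u v + l * step p (a, b) u v) \<in> \<W>"
      using f(1) by (intro \<W>_add step_in_\<W>) (simp add: \<W>\<^sub>0\<^sub>1_def)
    ultimately show ?thesis by (simp add: \<W>\<^sub>0\<^sub>1_def)
  qed
  have "?D \<inter> ball 0 \<epsilon> - {0} \<noteq> {}" if "\<epsilon> > 0" for \<epsilon>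
  proof -
    \<comment> \<open>The interval [-c, 1 - c] has length 1, so it reaches at least 1/2 to one side
      of 0.\<close>
    define m where "m = min (\<epsilon> / 2) (1 / 2)"
    have m: "0 < m" "m < \<epsilon>" "m \<le> 1 / 2" using that by (auto simp: m_def min_def)
    show ?thesis
    proof (cases "c \<le> 1 / 2")
      case True
      then have "m \<in> ?D \<inter> ball 0 \<epsilon> - {0}" using m c inD[of m] by auto
      then show ?thesis by blast
    next
      case False
      then have "- m \<in> ?D \<inter> ball 0 \<epsilon> - {0}" using m c inD[of "- m"] by auto
      then show ?thesis by blast
    qed
  qed
  then show ?thesis by (simp add: not_trivial_limit_within_ball)
qed

section \<open>Densities of cellwise constant kernels and their derivatives\<close>

lemma emeasure_cell:
  assumes "a \<in> {1..p}"
  shows "cell p a \<in> sets (lebesgue_on {0..1})" "emeasure (lebesgue_on {0..1}) (cell p a) = ennreal (1 / real p)"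
proof -
  have sub: "cell p a \<subseteq> {0..1}" using assms by (rule cell_subset)
  have borel: "cell p a \<in> sets borel" by (simp add: cell_def)
  show "cell p a \<in> sets (lebesgue_on {0..1})"
    using sub borel by (auto simp: sets_restrict_space image_iff intro!: bexI[of _ "cell p a"])
  have "emeasure (lebesgue_on {0..1}) (cell p a) = emeasure lebesgue (cell p a)"
    using sub by (intro emeasure_restrict_space) auto
  also have "\<dots> = emeasure lborel (cell p a)"
    using borel by simp
  also have "\<dots> = ennreal (real a / real p - (real a - 1) / real p)"
    unfolding cell_def by (intro emeasure_lborel_Ioc) (simp add: divide_right_mono)
  also have "real a / real p - (real a - 1) / real p = 1 / real p"
    by (simp add: diff_divide_distrib[symmetric])
  finally show "emeasure (lebesgue_on {0..1}) (cell p a) = ennreal (1 / real p)" .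
qed

text \<open>The integrand is constant on each box of cells, and each box has measure p^(-|V(H)|).
  Both sides of the expansion agree at every point of the cube, so no exceptional null set
  appears.\<close>

lemma hom_density_cellwise:
  assumes H: "is_multigraph H" "non_isolated H = verts H" and p: "p > 0" and f: "cellwise p f"
  shows "hom_density H f = (\<Sum>\<phi>\<in>verts H \<rightarrow>\<^sub>E {1..p}.
    \<Prod>e\<in>edges H. f (real (\<phi> (src H e)) / real p) (real (\<phi> (tgt H e)) / real p)) / real p ^ card (verts H)"
proof -
  let ?V = "verts H" and ?M1 = "lebesgue_on {0..1::real}"
  let ?M = "Pi\<^sub>M ?V (\<lambda>_. ?M1)"
  let ?\<Phi> = "?V \<rightarrow>\<^sub>E {1..p}"
  let ?c = "\<lambda>\<phi>. \<Prod>e\<in>edges H. f (real (\<phi> (src H e)) / real p) (real (\<phi> (tgt H e)) / real p)"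
  let ?R = "\<lambda>\<phi>. Pi\<^sub>E ?V (\<lambda>v. cell p (\<phi> v))"
  have finV: "finite ?V" using H(1) by (rule finite_verts)
  have fin\<Phi>: "finite ?\<Phi>" using finV by (intro finite_PiE) auto
  have edge: "src H e \<in> ?V" "tgt H e \<in> ?V" if "e \<in> edges H" for e
    using H(1) that by (auto simp: is_multigraph_def)
  interpret M1: finite_measure ?M1
    by (rule finite_measure_lebesgue_on) auto
  interpret product_sigma_finite "\<lambda>_. ?M1" ..
  have R: "?R \<phi> \<in> sets ?M" "emeasure ?M (?R \<phi>) = ennreal ((1 / real p) ^ card ?V)" if "\<phi> \<in> ?\<Phi>" for \<phi>
  proof -
    have cell: "cell p (\<phi> v) \<in> sets ?M1" "emeasure ?M1 (cell p (\<phi> v)) = ennreal (1 / real p)" if "v \<in> ?V" for v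
      using emeasure_cell[OF PiE_mem[OF \<open>\<phi> \<in> ?\<Phi>\<close> that]] by simp_all
    show "?R \<phi> \<in> sets ?M"
      using finV cell(1) by (intro sets_PiM_I_finite)
    have "emeasure ?M (?R \<phi>) = (\<Prod>v\<in>?V. emeasure ?M1 (cell p (\<phi> v)))"
      using cell(1) by (intro emeasure_PiM[OF finV])
    also have "\<dots> = ennreal ((1 / real p) ^ card ?V)"
      using cell(2) by (simp add: ennreal_power)
    finally show "emeasure ?M (?R \<phi>) = ennreal ((1 / real p) ^ card ?V)" .
  qed
  have ptw: "(\<Prod>e\<in>edges H. f (x (src H e)) (x (tgt H e))) = (\<Sum>\<phi>\<in>?\<Phi>. ?c \<phi> * indicator (?R \<phi>) x)"
    if "x \<in> space ?M" for x
  proof -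
    have x: "x \<in> ?V \<rightarrow>\<^sub>E {0..1}" using that by (simp add: space_PiM)
    show ?thesis
    proof (cases "\<exists>v\<in>?V. x v = 0")
      \<comment> \<open>A point with a zero coordinate lies in no box. The integrand is zero there
        as well: the vertex is an endpoint of some edge, and \<open>f\<close> vanishes when an
        argument is 0.\<close>
      case True
      then obtain v where v: "v \<in> ?V" "x v = 0" by auto
      then obtain e where e: "e \<in> edges H" "v \<in> ends H e"
        using H(2) by (auto simp: non_isolated_def)
      then have "f (x (src H e)) (x (tgt H e)) = 0"
        using f v(2) by (auto simp: cellwise_def ends_def)
      then have "(\<Prod>e\<in>edges H. f (x (src H e)) (x (tgt H e))) = 0"
        using e(1) finite_edges[OF H(1)] by (auto intro: prod_zero)
      moreover have "x \<notin> ?R \<phi>" if "\<phi> \<in> ?\<Phi>" for \<phi>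
      proof
        assume "x \<in> ?R \<phi>"
        then have "x v \<in> cell p (\<phi> v)" using v(1) by (rule PiE_mem)
        then show False using PiE_mem[OF that v(1)] zero_notin_cell[of "\<phi> v" p] v(2) by simp
      qed
      then have "(\<Sum>\<phi>\<in>?\<Phi>. ?c \<phi> * indicator (?R \<phi>) x) = 0"
        by (intro sum.neutral) auto
      ultimately show ?thesis by simp
    next
      case False
      have "\<exists>a. a \<in> {1..p} \<and> x v \<in> cell p a" if "v \<in> ?V" for v
        using cell_cover[of "x v" p] PiE_mem[OF x that] False that p by metis
      then obtain a where a: "\<And>v. v \<in> ?V \<Longrightarrow> a v \<in> {1..p} \<and> x v \<in> cell p (a v)"
        by metis
      define \<phi> where "\<phi> = restrict a ?V"
      have \<phi>: "\<phi> \<in> ?\<Phi>" "\<And>v. v \<in> ?V \<Longrightarrow> \<phi> v = a v" using a by (auto simp: \<phi>_def)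
      have "x \<in> ?R \<phi>'  \<longleftrightarrow> \<phi>' = \<phi>" if "\<phi>' \<in> ?\<Phi>" for \<phi>'
      proof
        assume "x \<in> ?R \<phi>'"
        then have "\<phi>' v = \<phi> v" if "v \<in> ?V" for v
          using cell_unique[of "x v" p "\<phi>' v" "\<phi> v"] a[OF that] \<phi>(2)[OF that] that p by auto
        then show "\<phi>' = \<phi>" using \<open>\<phi>' \<in> ?\<Phi>\<close> \<phi>(1) by (auto intro: PiE_ext)
      next
        assume "\<phi>' = \<phi>"
        then show "x \<in> ?R \<phi>'" using x a \<phi> by (auto simp: PiE_iff)
      qed
      then have "(\<Sum>\<phi>'\<in>?\<Phi>. ?c \<phi>' * indicator (?R \<phi>') x) = (\<Sum>\<phi>'\<in>?\<Phi>. if \<phi>' = \<phi> then ?c \<phi>' else 0)"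
        by (intro sum.cong) (auto simp: indicator_def)
      also have "\<dots> = ?c \<phi>"
        using fin\<Phi> \<phi>(1) by simp
      also have "\<dots> = (\<Prod>e\<in>edges H. f (x (src H e)) (x (tgt H e)))"
      proof (rule prod.cong)
        fix e assume "e \<in> edges H"
        note e = edge[OF this]
        show "f (real (\<phi> (src H e)) / real p) (real (\<phi> (tgt H e)) / real p) = f (x (src H e)) (x (tgt H e))"
          using f a[OF e(1)] a[OF e(2)] \<phi>(2)[OF e(1)] \<phi>(2)[OF e(2)] unfolding cellwise_def by metis
      qed simp
      finally show ?thesis by simp
    qed
  qed
  have "hom_density H f = (LINT x|completion ?M. (\<Sum>\<phi>\<in>?\<Phi>. ?c \<phi> * indicator (?R \<phi>) x))"
    unfolding hom_density_def using ptw by (intro Bochner_Integration.integral_cong) simp_all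
  \<comment> \<open>A combination of indicators of boxes is measurable before completion, so the
    completed integral is the ordinary one.\<close>
  also have "\<dots> = (LINT x|?M. (\<Sum>\<phi>\<in>?\<Phi>. ?c \<phi> * indicator (?R \<phi>) x))"
    using R(1) by (intro integral_completion borel_measurable_sum borel_measurable_times
        borel_measurable_const borel_measurable_indicator)
  also have "\<dots> = (\<Sum>\<phi>\<in>?\<Phi>. LINT x|?M. ?c \<phi> * indicator (?R \<phi>) x)"
    using R by (intro Bochner_Integration.integral_sum integrable_mult_right integrable_real_indicator) auto
  also have "\<dots> = (\<Sum>\<phi>\<in>?\<Phi>. ?c \<phi> * (1 / real p) ^ card ?V)"
  proof (rule sum.cong)
    fix \<phi> assume "\<phi> \<in> ?\<Phi>"
    then have "measure ?M (?R \<phi>) = (1 / real p) ^ card ?V"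
      using R(2) by (simp add: measure_def)
    then show "(LINT x|?M. ?c \<phi> * indicator (?R \<phi>) x) = ?c \<phi> * (1 / real p) ^ card ?V"
      using R(1)[OF \<open>\<phi> \<in> ?\<Phi>\<close>] sets.sets_into_space[OF R(1)[OF \<open>\<phi> \<in> ?\<Phi>\<close>]]
      by (simp add: Int_absorb2)
  qed simp
  finally show ?thesis
    by (simp add: sum_distrib_right[symmetric] power_one_over sum_divide_distrib)
qed

text \<open>The base point must be arbitrary, because the derivative of the next order compares
  values at \<open>f\<close> and at \<open>f\<close> plus a multiple of the step kernel; such
  perturbations stay cellwise constant.\<close>

lemma gateaux_hom_density:
  assumes H: "is_multigraph H" "non_isolated H = verts H" and p: "p > 0" and "valid_tuple k p x"
    and "f \<in> \<W>\<^sub>0\<^sub>1" "cellwise p f"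
  shows "gateaux k (hom_density H) f (\<lambda>l. step p (x l)) = (\<Sum>\<phi>\<in>verts H \<rightarrow>\<^sub>E {1..p}.
    prod_deriv k (\<lambda>l e. step p (x l) (real (\<phi> (src H e)) / real p) (real (\<phi> (tgt H e)) / real p)) (edges H)
      (\<lambda>e. f (real (\<phi> (src H e)) / real p) (real (\<phi> (tgt H e)) / real p))) / real p ^ card (verts H)"
  using assms(4-)
proof (induction k arbitrary: f)
  case 0
  then show ?case by (simp add: hom_density_cellwise[OF H p])
next
  case (Suc k)
  let ?g = "\<lambda>l. step p (x l)" and ?N = "real p ^ card (verts H)"
  let ?at = "\<lambda>(f::kernel) \<phi> e. f (real (\<phi> (src H e)) / real p) (real (\<phi> (tgt H e)) / real p)"
  let ?G = "\<lambda>f. (\<Sum>\<phi>\<in>verts H \<rightarrow>\<^sub>E {1..p}. prod_deriv k (\<lambda>l. ?at (?g l) \<phi>) (edges H) (?at f \<phi>)) / ?N"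
  let ?f = "\<lambda>l u v. f u v + l * ?g (Suc k) u v"
  let ?D = "{l. ?f l \<in> \<W>\<^sub>0\<^sub>1}"
  obtain a b where x: "x (Suc k) = (a, b)" by (cases "x (Suc k)")
  have ab: "1 \<le> a" "a < b" "b \<le> p"
    using bspec[OF Suc.prems(1)[unfolded valid_tuple_def], of "Suc k"] x by auto
  have valid: "valid_tuple k p x"
    using Suc.prems(1) by (simp add: valid_tuple_def)
  have cw: "cellwise p (?f l)" for l
    using Suc.prems(3) ab p unfolding x by (intro cellwise_add cellwise_step) auto
  \<comment> \<open>The induction hypothesis holds only at admissible step sizes, which suffices for
    a limit within \<open>?D\<close>.\<close>
  have eq: "gateaux k (hom_density H) (?f l) ?g = ?G (?f l)" if "l \<in> ?D" for l
    using Suc.IH[OF valid _ cw] that by simp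
  have eq0: "gateaux k (hom_density H) f ?g = ?G (?f 0)"
    using Suc.IH[OF valid Suc.prems(2,3)] by simp
  define D where "D = (\<Sum>\<phi>\<in>verts H \<rightarrow>\<^sub>E {1..p}.
    prod_deriv (Suc k) (\<lambda>l. ?at (?g l) \<phi>) (edges H) (?at f \<phi>)) / ?N"
  \<comment> \<open>The closed formula is differentiable from both sides; admissibility enters only
    through the restricted filter afterwards.\<close>
  have "((\<lambda>l. ?G (?f l)) has_field_derivative D) (at 0)"
    unfolding D_def prod_deriv.simps
    by (intro DERIV_cdivide DERIV_sum has_field_derivative_prod_deriv finite_edges[OF H(1)])
  then have "((\<lambda>l. ?G (?f l)) has_field_derivative D) (at 0 within ?D)"
    by (rule has_field_derivative_at_within)
  then have "((\<lambda>l. (?G (?f l) - ?G (?f 0)) / (l - 0)) \<longlongrightarrow> D) (at 0 within ?D)"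
    by (simp only: has_field_derivative_iff)
  moreover have "\<forall>\<^sub>F l in at 0 within ?D. (?G (?f l) - ?G (?f 0)) / (l - 0) =
      1 / l * (gateaux k (hom_density H) (?f l) ?g - gateaux k (hom_density H) f ?g)"
    unfolding eventually_at_filter using eq eq0 by (intro always_eventually allI impI) simp
  ultimately have "((\<lambda>l. 1 / l * (gateaux k (hom_density H) (?f l) ?g - gateaux k (hom_density H) f ?g))
      \<longlongrightarrow> D) (at 0 within ?D)"
    by (rule Lim_transform_eventually)
  \<comment> \<open>Nontriviality of the filter is what identifies \<open>Lim\<close> with the limit
    found.\<close>
  then have "gateaux (Suc k) (hom_density H) f ?g = D"
    using at_within_directions_nontrivial[OF Suc.prems(2,3) ab] x
    by (simp only: gateaux.simps) (rule tendsto_Lim)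
  then show ?case by (simp only: D_def)
qed

section \<open>Derivatives at zero count surjections\<close>

lemma prod_of_bool: "finite S \<Longrightarrow> (\<Prod>e\<in>S. of_bool (P e)) = (of_bool (\<forall>e\<in>S. P e) :: real)"
  by (induction S rule: finite_induct) auto

lemma gateaux_step_zero:
  assumes H: "is_multigraph H" "non_isolated H = verts H" and p: "p > 0" and x: "valid_tuple n p x"
  shows "gateaux n (hom_density H) (\<lambda>_ _. 0) (\<lambda>l. step p (x l)) =
    (\<Sum>\<phi>\<in>verts H \<rightarrow>\<^sub>E {1..p}. \<Sum>\<psi>\<in>bijections (edges H) n.
      \<Prod>e\<in>edges H. of_bool (\<phi> ` ends H e = ends (\<Gamma> n p x) (\<psi> e))) / real p ^ card (verts H)"
proof -
  have fin: "finite (edges H)" using H(1) by (rule finite_edges)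
  have st: "step p (x (\<psi> e)) (real (\<phi> (src H e)) / real p) (real (\<phi> (tgt H e)) / real p) =
      of_bool (\<phi> ` ends H e = ends (\<Gamma> n p x) (\<psi> e))"
    if "\<psi> \<in> bijections (edges H) n" "e \<in> edges H" for \<phi> \<psi> e
  proof -
    have "\<psi> e \<in> {1..n}" using that by (auto simp: bijections_def)
    then have "fst (x (\<psi> e)) < snd (x (\<psi> e))"
      using x by (auto simp: valid_tuple_def)
    from step_endpoint[OF this p] show ?thesis
      by (simp add: ends_def[of H])
  qed
  have "cellwise p (\<lambda>_ _. 0)" by (simp add: cellwise_def)
  from gateaux_hom_density[OF H p x zero_in_\<W>\<^sub>0\<^sub>1 this] show ?thesis
    by (simp only: prod_deriv_zero[OF fin] st cong: sum.cong prod.cong)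
qed

text \<open>Both multigraphs have \<open>n\<close> edges, so the surjective edge maps are the
  bijections. The vertex maps may range over all of \<open>{1..p}\<close>: every vertex of
  \<open>H\<close> lies on an edge, so compatibility forces the image to be exactly the set of
  endpoints, the vertex set after stripping.\<close>

lemma sum_eq_card_Surj:
  assumes H: "is_multigraph H" "non_isolated H = verts H" "card (edges H) = n"
  shows "(\<Sum>\<phi>\<in>verts H \<rightarrow>\<^sub>E {1..p}. \<Sum>\<psi>\<in>bijections (edges H) n.
      \<Prod>e\<in>edges H. of_bool (\<phi> ` ends H e = ends (\<Gamma> n p x) (\<psi> e))) = real (card (Surj H (strip (\<Gamma> n p x))))"
proof -
  let ?\<Phi> = "verts H \<rightarrow>\<^sub>E {1..p}" and ?B = "bijections (edges H) n"
  let ?P = "\<lambda>\<phi> \<psi>. \<forall>e\<in>edges H. \<phi> ` ends H e = ends (\<Gamma> n p x) (\<psi> e)"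
  have fin: "finite (edges H)" "finite ?\<Phi>" "finite ?B"
    using H(1) finite_verts by (auto intro!: finite_PiE finite_bijections finite_edges)
  have "(\<Sum>\<phi>\<in>?\<Phi>. \<Sum>\<psi>\<in>?B. \<Prod>e\<in>edges H. of_bool (\<phi> ` ends H e = ends (\<Gamma> n p x) (\<psi> e))) =
      (\<Sum>(\<phi>, \<psi>)\<in>?\<Phi> \<times> ?B. (of_bool (?P \<phi> \<psi>) :: real))"
    by (simp only: sum.cartesian_product prod_of_bool[OF fin(1)])
  also have "\<dots> = (\<Sum>z\<in>?\<Phi> \<times> ?B. (of_bool (?P (fst z) (snd z)) :: real))"
    by (simp add: case_prod_beta)
  also have "\<dots> = real (card ((?\<Phi> \<times> ?B) \<inter> {z. ?P (fst z) (snd z)}))"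
    using fin by (simp add: sum_of_bool_eq)
  also have "(?\<Phi> \<times> ?B) \<inter> {z. ?P (fst z) (snd z)} = Surj H (strip (\<Gamma> n p x))" (is "?L = ?R")
  proof (intro equalityI subsetI)
    fix z assume z: "z \<in> ?L"
    obtain \<phi> \<psi> where z_eq: "z = (\<phi>, \<psi>)" by (cases z)
    have *: "\<phi> \<in> ?\<Phi>" "\<psi> \<in> edges H \<rightarrow>\<^sub>E {1..n}" "\<psi> ` edges H = {1..n}" "?P \<phi> \<psi>"
      using z z_eq by (auto simp: bijections_def bij_betw_def)
    have "\<phi> v \<in> non_isolated (\<Gamma> n p x)" if v: "v \<in> verts H" for v
    proof -
      obtain e where "e \<in> edges H" "v \<in> ends H e"
        using v H(2) by (auto simp: non_isolated_def)
      then have "\<phi> v \<in> ends (\<Gamma> n p x) (\<psi> e)" "\<psi> e \<in> edges (\<Gamma> n p x)"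
        using *(4) PiE_mem[OF *(2)] by auto
      moreover have "\<phi> v \<in> verts (\<Gamma> n p x)"
        using PiE_mem[OF *(1) v] by simp
      ultimately show ?thesis by (auto simp only: non_isolated_def)
    qed
    moreover have "w \<in> \<phi> ` verts H" if w: "w \<in> non_isolated (\<Gamma> n p x)" for w
    proof -
      obtain l where "l \<in> {1..n}" "w \<in> ends (\<Gamma> n p x) l"
        using w by (auto simp: non_isolated_def)
      then obtain e where "e \<in> edges H" "w \<in> \<phi> ` ends H e"
        using *(3,4) by (metis imageE)
      then show ?thesis using ends_subset_verts[OF H(1)] by blast
    qed
    ultimately have "\<phi> \<in> verts H \<rightarrow>\<^sub>E non_isolated (\<Gamma> n p x)" "\<phi> ` verts H = non_isolated (\<Gamma> n p x)"
      using *(1) by (auto simp: PiE_def)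
    then show "z \<in> ?R"
      using * unfolding z_eq Surj_def multigraph_maps_def by simp
  next
    fix z assume z: "z \<in> ?R"
    obtain \<phi> \<psi> where z_eq: "z = (\<phi>, \<psi>)" by (cases z)
    have *: "\<phi> \<in> verts H \<rightarrow>\<^sub>E non_isolated (\<Gamma> n p x)" "\<psi> \<in> edges H \<rightarrow>\<^sub>E {1..n}"
      "\<psi> ` edges H = {1..n}" "?P \<phi> \<psi>"
      using z unfolding z_eq Surj_def multigraph_maps_def by auto
    have "inj_on \<psi> (edges H)"
      using fin(1) H(3) *(3) by (intro eq_card_imp_inj_on) auto
    then have "\<psi> \<in> ?B" using *(2,3) by (simp add: bijections_def bij_betw_def)
    moreover have "\<phi> \<in> ?\<Phi>"
      using *(1) non_isolated_subset[of "\<Gamma> n p x"] by (auto simp: PiE_iff)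
    ultimately show "z \<in> ?L" using *(4) z_eq by simp
  qed
  finally show ?thesis .
qed

text \<open>The condition under \<open>THE\<close> quantifies over tuples representing
  \<open>h\<close>; by \<open>ex_\<Gamma>\<close> there is one, so the condition is not vacuous and
  fixes the value.\<close>

lemma T_eqI:
  assumes "h \<in> \<H>\<^sub>n\<^sub>p n p"
    and "\<And>x. x \<in> pair_tuples n p \<Longrightarrow> \<Gamma> n p x \<in> h \<Longrightarrow>
      gateaux n F (\<lambda>_ _. 0) (\<lambda>l. step p (x l)) = r"
  shows "T n p F h = r"
  unfolding T_def
proof (rule the_equality)
  show "\<forall>x\<in>pair_tuples n p. \<Gamma> n p x \<in> h \<longrightarrow> r = gateaux n F (\<lambda>_ _. 0) (\<lambda>l. step p (x l))"
    using assms(2) by simp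
  obtain x where x: "x \<in> pair_tuples n p" "h = graph_iso `` {\<Gamma> n p x}"
    using assms(1) by (rule ex_\<Gamma>)
  then have "\<Gamma> n p x \<in> h"
    using graph_iso_refl is_multigraph_\<Gamma> valid_pair_tuples by simp
  then show "s = r"
    if "\<forall>x\<in>pair_tuples n p. \<Gamma> n p x \<in> h \<longrightarrow> s = gateaux n F (\<lambda>_ _. 0) (\<lambda>l. step p (x l))" for s
    using assms(2)[OF x(1)] that x(1) by simp
qed

lemma T_eq_0:
  assumes H: "is_multigraph H" "non_isolated H = verts H" "card (edges H) \<noteq> n"
    and "p > 0" "h \<in> \<H>\<^sub>n\<^sub>p n p"
  shows "T n p (hom_density H) h = 0"
proof (rule T_eqI[OF assms(5)])
  fix x assume "x \<in> pair_tuples n p"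
  then show "gateaux n (hom_density H) (\<lambda>_ _. 0) (\<lambda>l. step p (x l)) = 0"
    using gateaux_step_zero[OF H(1,2) assms(4) valid_pair_tuples] bijections_empty[OF H(3)] by simp
qed

lemma T_eq_card_Surj:
  assumes H: "is_multigraph H" "non_isolated H = verts H" "card (edges H) = n"
    and "p > 0" "h \<in> \<H>\<^sub>n\<^sub>p n p" "G \<in> strip_class h"
  shows "T n p (hom_density H) h = real (card (Surj H G)) / real p ^ card (verts H)"
proof (rule T_eqI[OF assms(5)])
  fix x assume x: "x \<in> pair_tuples n p" "\<Gamma> n p x \<in> h"
  obtain K where K: "is_multigraph K" "h = graph_iso `` {K}"
    using assms(5) by (rule \<H>\<^sub>n\<^sub>pE)
  have "(strip K, G) \<in> graph_iso"
    using assms(6) K strip_class_graph_iso by auto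
  moreover have "(strip K, strip (\<Gamma> n p x)) \<in> graph_iso"
    using x(2) K(2) graph_iso_strip by auto
  ultimately have "(strip (\<Gamma> n p x), G) \<in> graph_iso"
    using graph_iso_sym graph_iso_trans by blast
  then show "gateaux n (hom_density H) (\<lambda>_ _. 0) (\<lambda>l. step p (x l)) =
      real (card (Surj H G)) / real p ^ card (verts H)"
    using gateaux_step_zero[OF H(1,2) assms(4) valid_pair_tuples[OF x(1)]]
      sum_eq_card_Surj[OF H] card_Surj_cong[OF H(1)] by simp
qed

section \<open>Refinement of tuples\<close>

text \<open>The cell of mesh 1 / p that contains the cell \<open>c\<close> of mesh 1 / (k p); the
  shifts appear because cells are numbered from 1.\<close>

definition parent :: "nat \<Rightarrow> nat \<Rightarrow> nat" where
  "parent k c = (c - 1) div k + 1"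

lemma parent_child: "a \<ge> 1 \<Longrightarrow> i \<in> {1..k} \<Longrightarrow> parent k (k * (a - 1) + i) = a"
proof -
  assume "a \<ge> 1" "i \<in> {1..k}"
  then have "k * (a - 1) + i - 1 = (i - 1) + k * (a - 1)" "i - 1 < k" by auto
  then show ?thesis using \<open>a \<ge> 1\<close> unfolding parent_def by simp
qed

text \<open>Division of \<open>c - 1\<close> by \<open>k\<close> with remainder, the offset
  \<open>i\<close> being the remainder counted from 1.\<close>

lemma eq_child_iff:
  assumes "c \<ge> 1" "a \<ge> 1" "i \<in> {1..k}"
  shows "c = k * (a - 1) + i \<longleftrightarrow> parent k c = a \<and> i = (c - 1) mod k + 1"
proof
  assume "c = k * (a - 1) + i"
  then have "c - 1 = (i - 1) + k * (a - 1)" "i - 1 < k" using assms(3) by auto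
  then have "(c - 1) mod k = i - 1" "(c - 1) div k = a - 1" by simp_all
  then show "parent k c = a \<and> i = (c - 1) mod k + 1"
    using assms by (simp add: parent_def)
next
  assume "parent k c = a \<and> i = (c - 1) mod k + 1"
  then have "a - 1 = (c - 1) div k" "i - 1 = (c - 1) mod k" "i \<ge> 1"
    by (auto simp: parent_def)
  then have "c - 1 = k * (a - 1) + (i - 1)" by simp
  then show "c = k * (a - 1) + i" using assms(1) \<open>i \<ge> 1\<close> by simp
qed

lemma parent_fiber:
  assumes "a \<in> {1..p}" shows "card {c \<in> {1..k * p}. parent k c = a} = k"
proof -
  have le: "k * (a - 1) + k \<le> k * p"
    using assms by (metis atLeastAtMost_iff le_add_diff_inverse2 mult.right_neutral mult_le_mono2 nat_distrib(2))
  have "{c \<in> {1..k * p}. parent k c = a} = (\<lambda>i. k * (a - 1) + i) ` {1..k}"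
  proof (intro equalityI subsetI)
    fix c assume "c \<in> {c \<in> {1..k * p}. parent k c = a}"
    then have c: "c \<ge> 1" "c \<le> k * p" "parent k c = a" by auto
    then have "k > 0" by (cases k) auto
    then have "(c - 1) mod k + 1 \<in> {1..k}" using mod_less_divisor[of k "c - 1"] by (simp add: Suc_le_eq)
    moreover from this have "c = k * (a - 1) + ((c - 1) mod k + 1)"
      using eq_child_iff[OF c(1), of a "(c - 1) mod k + 1" k] c(3) assms by simp
    ultimately show "c \<in> (\<lambda>i. k * (a - 1) + i) ` {1..k}" by blast
  next
    fix c assume "c \<in> (\<lambda>i. k * (a - 1) + i) ` {1..k}"
    then obtain i where i: "i \<in> {1..k}" "c = k * (a - 1) + i" by blast
    then show "c \<in> {c \<in> {1..k * p}. parent k c = a}"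
      using parent_child[OF _ i(1), of a] assms le by auto
  qed
  then show ?thesis by (simp add: card_image inj_on_def)
qed

lemma parent_in: "c \<in> {1..k * p} \<Longrightarrow> parent k c \<in> {1..p}"
proof -
  assume "c \<in> {1..k * p}"
  then have "c - 1 < p * k" by (auto simp: mult.commute)
  then have "(c - 1) div k < p" by (rule less_mult_imp_div_less)
  then show ?thesis by (simp add: parent_def)
qed

lemma refine_simps [simp]:
  "fst (refine k z w) = k * (fst z - 1) + fst w" "snd (refine k z w) = k * (snd z - 1) + snd w"
  by (auto simp: refine_def case_prod_beta)

text \<open>Combinatorial form of the fact that a coarse step kernel is the sum of its refinements:
  if the parents match, quotient and remainder determine exactly one refined pair equal to {c,
  d}.\<close>

lemma sum_refine:
  assumes "k \<ge> 1" "1 \<le> fst z" "fst z < snd z" "c \<ge> 1" "d \<ge> 1"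
  shows "(\<Sum>w\<in>{1..k} \<times> {1..k}. of_bool ({c, d} = {fst (refine k z w), snd (refine k z w)})) =
    (of_bool ({parent k c, parent k d} = {fst z, snd z}) :: real)"
proof -
  let ?K = "{1..k} \<times> {1..k}" and ?r = "\<lambda>c. (c - 1) mod k + 1"
  have r: "?r c \<in> {1..k}" for c
    using assms(1) mod_less_divisor[of k "c - 1"] by (simp add: Suc_le_eq)
  let ?A = "parent k c = fst z \<and> parent k d = snd z" and ?B = "parent k c = snd z \<and> parent k d = fst z"
  have eq: "{c, d} = {fst (refine k z w), snd (refine k z w)} \<longleftrightarrow>
      (?A \<and> w = (?r c, ?r d)) \<or> (?B \<and> w = (?r d, ?r c))" if wK: "w \<in> ?K" for w
  proof -
    obtain i j where w: "w = (i, j)" "i \<in> {1..k}" "j \<in> {1..k}" using wK by blast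
    have z: "fst z \<ge> 1" "snd z \<ge> 1" using assms by auto
    show ?thesis
      using eq_child_iff[OF assms(4) z(1) w(2)] eq_child_iff[OF assms(4) z(2) w(3)]
        eq_child_iff[OF assms(5) z(1) w(2)] eq_child_iff[OF assms(5) z(2) w(3)] w(1)
      unfolding doubleton_eq_iff refine_simps by auto
  qed
  have "(\<Sum>w\<in>?K. of_bool ({c, d} = {fst (refine k z w), snd (refine k z w)})) =
      (\<Sum>w\<in>?K. of_bool ((?A \<and> w = (?r c, ?r d)) \<or> (?B \<and> w = (?r d, ?r c))) :: real)"
    using eq by (intro sum.cong arg_cong[where f = of_bool]) auto
  also have "\<dots> = real (card (?K \<inter> {w. (?A \<and> w = (?r c, ?r d)) \<or> (?B \<and> w = (?r d, ?r c))}))"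
    by (subst sum_of_bool_eq[of ?K "\<lambda>w. (?A \<and> w = (?r c, ?r d)) \<or> (?B \<and> w = (?r d, ?r c))"])
      auto
  \<comment> \<open>Since \<open>fst z < snd z\<close>, the two orientations exclude each other and
    at most one offset pair remains.\<close>
  also have "?K \<inter> {w. (?A \<and> w = (?r c, ?r d)) \<or> (?B \<and> w = (?r d, ?r c))} =
      (if ?A then {(?r c, ?r d)} else if ?B then {(?r d, ?r c)} else {})"
    using r[of c] r[of d] assms(3) by auto
  also have "real (card \<dots>) = of_bool ({parent k c, parent k d} = {fst z, snd z})"
    by (auto simp: doubleton_eq_iff)
  finally show ?thesis .
qed

definition refinements :: "nat \<Rightarrow> nat \<Rightarrow> (nat \<Rightarrow> nat \<times> nat) set" where
  "refinements n k = {1..n} \<rightarrow>\<^sub>E {1..k} \<times> {1..k}"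

definition refine_tuple :: "nat \<Rightarrow> (nat \<Rightarrow> nat \<times> nat) \<Rightarrow> (nat \<Rightarrow> nat \<times> nat) \<Rightarrow> nat \<Rightarrow> nat \<times> nat" where
  "refine_tuple k x ij = (\<lambda>l. refine k (x l) (ij l))"

lemma finite_refinements: "finite (refinements n k)"
  by (auto simp: refinements_def intro: finite_PiE)

lemma valid_refine_tuple:
  assumes "valid_tuple n p x" "ij \<in> refinements n k"
  shows "valid_tuple n (k * p) (refine_tuple k x ij)"
  unfolding valid_tuple_def
proof
  fix l assume l: "l \<in> {1..n}"
  obtain i j where ij: "ij l = (i, j)" "i \<in> {1..k}" "j \<in> {1..k}"
    using PiE_mem[OF assms(2)[unfolded refinements_def] l] by auto
  obtain a b where ab: "x l = (a, b)" "1 \<le> a" "a < b" "b \<le> p"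
    using bspec[OF assms(1)[unfolded valid_tuple_def] l] by (cases "x l") auto
  \<comment> \<open>Children of \<open>a\<close> occupy \<open>k\<close> consecutive indices; as
    \<open>a \<le> b - 1\<close>, this block ends before that of \<open>b\<close> begins, so refined
    pairs stay increasing.\<close>
  have "k * (a - 1) + k \<le> k * (b - 1)" "k * (b - 1) + k \<le> k * p"
    using ab by (metis One_nat_def Suc_diff_1 Suc_leI diff_less_mono less_le_trans
        mult_Suc_right mult_le_mono2 add.commute le_trans less_imp_le_nat zero_less_one)+
  then show "1 \<le> fst (refine_tuple k x ij l) \<and>
      fst (refine_tuple k x ij l) < snd (refine_tuple k x ij l) \<and>
      snd (refine_tuple k x ij l) \<le> k * p"
    using ij by (simp add: refine_tuple_def ab(1))
qed

text \<open>Each map into the coarse cells has \<open>k\<close> lifts at every vertex, chosen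
  independently.\<close>

lemma sum_parent:
  fixes F :: "('v \<Rightarrow> nat) \<Rightarrow> real"
  assumes "finite V"
  shows "(\<Sum>\<phi>\<in>V \<rightarrow>\<^sub>E {1..k * p}. F (\<lambda>v\<in>V. parent k (\<phi> v))) = real k ^ card V * (\<Sum>\<phi>\<in>V \<rightarrow>\<^sub>E {1..p}. F \<phi>)"
proof -
  let ?P = "\<lambda>\<phi>. \<lambda>v\<in>V. parent k (\<phi> v)"
  have "(\<Sum>\<phi>\<in>V \<rightarrow>\<^sub>E {1..k * p}. F (?P \<phi>)) =
      (\<Sum>\<phi>'\<in>V \<rightarrow>\<^sub>E {1..p}. \<Sum>\<phi>\<in>{\<phi> \<in> V \<rightarrow>\<^sub>E {1..k * p}. ?P \<phi> = \<phi>'}. F (?P \<phi>))"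
    using assms parent_in by (intro sum.group[symmetric] finite_PiE) (auto simp: PiE_iff simp del: atLeastAtMost_iff)
  also have "\<dots> = (\<Sum>\<phi>'\<in>V \<rightarrow>\<^sub>E {1..p}. real k ^ card V * F \<phi>')"
  proof (rule sum.cong)
    fix \<phi>' assume \<phi>': "\<phi>' \<in> V \<rightarrow>\<^sub>E {1..p}"
    have "{\<phi> \<in> V \<rightarrow>\<^sub>E {1..k * p}. ?P \<phi> = \<phi>'} = (\<Pi>\<^sub>E v\<in>V. {c \<in> {1..k * p}. parent k c = \<phi>' v})"
      (is "?L = ?R")
    proof (intro equalityI subsetI)
      fix \<phi> assume \<phi>: "\<phi> \<in> ?L"
      then have "parent k (\<phi> v) = \<phi>' v" if "v \<in> V" for v
        using that by (auto simp: restrict_def)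
      then show "\<phi> \<in> ?R" using \<phi> by (auto simp: PiE_iff)
    next
      fix \<phi> assume \<phi>: "\<phi> \<in> ?R"
      then have "?P \<phi> v = \<phi>' v" for v
        using PiE_arb[OF \<phi>', of v] by (auto simp: PiE_iff restrict_def)
      then show "\<phi> \<in> ?L" using \<phi> by (auto simp: PiE_iff fun_eq_iff)
    qed
    moreover have "card ?R = (\<Prod>v\<in>V. k)"
      unfolding card_PiE[OF assms] using PiE_mem[OF \<phi>'] by (intro prod.cong parent_fiber) simp_all
    moreover have "(\<Sum>\<phi>\<in>?L. F (?P \<phi>)) = (\<Sum>\<phi>\<in>?L. F \<phi>')"
      by (rule sum.cong) auto
    ultimately show "(\<Sum>\<phi>\<in>?L. F (?P \<phi>)) = real k ^ card V * F \<phi>'"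
      by simp
  qed simp
  finally show ?thesis by (simp add: sum_distrib_left)
qed

text \<open>For a fixed vertex map into fine cells and a fixed edge bijection, the sum over
  refinements factorises over the edges, and \<open>sum_refine\<close> says that what remains is
  compatibility of the parent map. The factor k^|V(H)| counts the lifts of that map.\<close>

lemma sum_Surj_refine:
  assumes H: "is_multigraph H" "non_isolated H = verts H" "card (edges H) = n"
    and x: "valid_tuple n p x" and k: "k \<ge> 1"
  shows "(\<Sum>ij\<in>refinements n k. real (card (Surj H (strip (\<Gamma> n (k * p) (refine_tuple k x ij)))))) =
    real k ^ card (verts H) * real (card (Surj H (strip (\<Gamma> n p x))))"
proof -
  let ?V = "verts H" and ?E = "edges H" and ?B = "bijections (edges H) n" and ?I = "refinements n k"
  let ?K = "{1..k} \<times> {1..k}"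
  have fin: "finite ?V" "finite ?E" "finite ?B" "finite ?I"
    using H(1) finite_verts finite_edges finite_refinements by (auto intro!: finite_bijections)
  define G where "G \<phi> e l w = (of_bool (\<phi> ` ends H e = {fst (refine k (x l) w), snd (refine k (x l) w)}) :: real)"
    for \<phi> e l w
  define F where "F \<phi> = (\<Sum>\<psi>\<in>?B. \<Prod>e\<in>?E. of_bool (\<phi> ` ends H e = ends (\<Gamma> n p x) (\<psi> e)) :: real)" for \<phi>
  have "(\<Sum>ij\<in>?I. real (card (Surj H (strip (\<Gamma> n (k * p) (refine_tuple k x ij)))))) =
      (\<Sum>ij\<in>?I. \<Sum>\<phi>\<in>?V \<rightarrow>\<^sub>E {1..k * p}. \<Sum>\<psi>\<in>?B. \<Prod>e\<in>?E. G \<phi> e (\<psi> e) (ij (\<psi> e)))"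
    by (simp only: sum_eq_card_Surj[OF H, symmetric] G_def \<Gamma>_simps refine_tuple_def)
  also have "\<dots> = (\<Sum>\<phi>\<in>?V \<rightarrow>\<^sub>E {1..k * p}. \<Sum>ij\<in>?I. \<Sum>\<psi>\<in>?B. \<Prod>e\<in>?E. G \<phi> e (\<psi> e) (ij (\<psi> e)))"
    by (rule sum.swap)
  also have "\<dots> = (\<Sum>\<phi>\<in>?V \<rightarrow>\<^sub>E {1..k * p}. F (\<lambda>v\<in>?V. parent k (\<phi> v)))"
  proof (rule sum.cong)
    fix \<phi> assume \<phi>: "\<phi> \<in> ?V \<rightarrow>\<^sub>E {1..k * p}"
    have "(\<Sum>ij\<in>?I. \<Prod>e\<in>?E. G \<phi> e (\<psi> e) (ij (\<psi> e))) =
        (\<Prod>e\<in>?E. of_bool ((\<lambda>v\<in>?V. parent k (\<phi> v)) ` ends H e = ends (\<Gamma> n p x) (\<psi> e)))"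
      if \<psi>: "\<psi> \<in> ?B" for \<psi>
    proof -
      have bij: "bij_betw \<psi> ?E {1..n}" using \<psi> by (simp add: bijections_def)
      let ?inv = "inv_into ?E \<psi>"
      have inv: "?inv (\<psi> e) = e" if "e \<in> ?E" for e
        using bij that by (simp add: bij_betw_def)
      have "(\<Sum>ij\<in>?I. \<Prod>e\<in>?E. G \<phi> e (\<psi> e) (ij (\<psi> e))) =
          (\<Sum>ij\<in>?I. \<Prod>e\<in>?E. G \<phi> (?inv (\<psi> e)) (\<psi> e) (ij (\<psi> e)))"
        using inv by simp
      \<comment> \<open>Indexing the factors by \<open>l\<close> instead of by edges makes each
        choice \<open>ij l\<close> occur in exactly one factor, so that sum and product can be
        exchanged.\<close>
      also have "\<dots> = (\<Sum>ij\<in>?I. \<Prod>l\<in>{1..n}. G \<phi> (?inv l) l (ij l))"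
        by (simp only: prod.reindex_bij_betw[OF bij, of "\<lambda>l. G \<phi> (?inv l) l (_ l)"])
      also have "\<dots> = (\<Prod>l\<in>{1..n}. \<Sum>w\<in>?K. G \<phi> (?inv l) l w)"
        unfolding refinements_def by (intro prod_sum_PiE[symmetric]) auto
      also have "\<dots> = (\<Prod>e\<in>?E. \<Sum>w\<in>?K. G \<phi> (?inv (\<psi> e)) (\<psi> e) w)"
        by (rule prod.reindex_bij_betw[OF bij, symmetric])
      also have "\<dots> = (\<Prod>e\<in>?E. of_bool ((\<lambda>v\<in>?V. parent k (\<phi> v)) ` ends H e = ends (\<Gamma> n p x) (\<psi> e)))"
      proof (rule prod.cong)
        fix e assume e: "e \<in> ?E"
        then have "\<psi> e \<in> {1..n}" using bij by (auto simp: bij_betw_def)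
        then have z: "1 \<le> fst (x (\<psi> e))" "fst (x (\<psi> e)) < snd (x (\<psi> e))"
          using x by (auto simp: valid_tuple_def)
        have v: "src H e \<in> ?V" "tgt H e \<in> ?V"
          using H(1) e by (auto simp: is_multigraph_def)
        then have "\<phi> (src H e) \<ge> 1" "\<phi> (tgt H e) \<ge> 1"
          using PiE_mem[OF \<phi>] by simp_all
        from sum_refine[OF k z this] v
        show "(\<Sum>w\<in>?K. G \<phi> (?inv (\<psi> e)) (\<psi> e) w) =
            of_bool ((\<lambda>v\<in>?V. parent k (\<phi> v)) ` ends H e = ends (\<Gamma> n p x) (\<psi> e))"
          by (simp only: inv[OF e] G_def ends_def[of H] image_insert image_empty \<Gamma>_simps restrict_apply if_True)
      qed simp
      finally show ?thesis .
    qed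
    then show "(\<Sum>ij\<in>?I. \<Sum>\<psi>\<in>?B. \<Prod>e\<in>?E. G \<phi> e (\<psi> e) (ij (\<psi> e))) = F (\<lambda>v\<in>?V. parent k (\<phi> v))"
      unfolding F_def by (subst sum.swap) (rule sum.cong, simp_all)
  qed simp
  also have "\<dots> = real k ^ card ?V * (\<Sum>\<phi>\<in>?V \<rightarrow>\<^sub>E {1..p}. F \<phi>)"
    by (rule sum_parent[OF fin(1)])
  also have "(\<Sum>\<phi>\<in>?V \<rightarrow>\<^sub>E {1..p}. F \<phi>) = real (card (Surj H (strip (\<Gamma> n p x))))"
    unfolding F_def by (rule sum_eq_card_Surj[OF H])
  finally show ?thesis .
qed

text \<open>Collapsing every fine cell to its parent, with the identity on edges, is
  surjective.\<close>

lemma Surj_refine_tuple: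
  assumes x: "valid_tuple n p x" and ij: "ij \<in> refinements n k"
  shows "Surj (strip (\<Gamma> n (k * p) (refine_tuple k x ij))) (strip (\<Gamma> n p x)) \<noteq> {}"
proof -
  let ?y = "refine_tuple k x ij"
  let ?G = "\<Gamma> n (k * p) ?y" and ?G' = "\<Gamma> n p x"
  have par: "parent k ` ends ?G l = ends ?G' l" if l: "l \<in> {1..n}" for l
  proof -
    obtain i j where ij: "ij l = (i, j)" "i \<in> {1..k}" "j \<in> {1..k}"
      using PiE_mem[OF ij[unfolded refinements_def] l] by auto
    have "fst (x l) \<ge> 1" "snd (x l) \<ge> 1"
      using bspec[OF x[unfolded valid_tuple_def] l] by auto
    then show ?thesis
      using ij by (simp only: refine_tuple_def \<Gamma>_simps refine_simps image_insert image_empty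
          parent_child fst_conv snd_conv)
  qed
  have im: "parent k ` non_isolated ?G = non_isolated ?G'"
    using par non_isolated_eq_Union[OF is_multigraph_\<Gamma>[OF x]]
      non_isolated_eq_Union[OF is_multigraph_\<Gamma>[OF valid_refine_tuple[OF x ij]]]
    by (simp add: image_UN del: \<Gamma>_simps(3))
  have "restrict (parent k) (non_isolated ?G) ` ends ?G l = ends ?G' l" if l: "l \<in> {1..n}" for l
  proof -
    have "ends ?G l \<subseteq> non_isolated ?G"
      using ends_subset_verts[OF is_multigraph_\<Gamma>[OF valid_refine_tuple[OF x ij]], of l] l
      by (auto simp: non_isolated_def simp del: \<Gamma>_simps(3))
    then have "restrict (parent k) (non_isolated ?G) ` ends ?G l = parent k ` ends ?G l"
      by (intro image_cong) auto
    then show ?thesis using par[OF l] by simp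
  qed
  then have "(restrict (parent k) (non_isolated ?G), restrict id {1..n}) \<in> Surj (strip ?G) (strip ?G')"
    using im unfolding Surj_def multigraph_maps_def by (auto simp del: \<Gamma>_simps(3))
  then show ?thesis by blast
qed

text \<open>Always taking the first child uses one fine cell per coarse cell, so no vertex is split.
  This supplies the nonzero diagonal for refinement.\<close>

lemma graph_iso_refine_tuple_const:
  assumes x: "valid_tuple n p x" and k: "k \<ge> 1"
  shows "(strip (\<Gamma> n p x), strip (\<Gamma> n (k * p) (refine_tuple k x (\<lambda>l\<in>{1..n}. (1, 1))))) \<in> graph_iso"
proof -
  define y where "y = refine_tuple k x (\<lambda>l\<in>{1..n}. (1, 1))"
  have "(\<lambda>l\<in>{1..n}. (1, 1)) \<in> refinements n k"
    using k by (auto simp: refinements_def)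
  from valid_refine_tuple[OF x this] have y: "valid_tuple n (k * p) y"
    by (simp only: y_def)
  let ?G = "\<Gamma> n p x" and ?G' = "\<Gamma> n (k * p) y"
  let ?c = "\<lambda>a. k * (a - 1) + 1"
  have ends: "ends ?G' l = ?c ` ends ?G l" if "l \<in> {1..n}" for l
    using that by (simp add: y_def refine_tuple_def)
  have "?c ` non_isolated ?G = non_isolated ?G'"
    using ends non_isolated_eq_Union[OF is_multigraph_\<Gamma>[OF x]]
      non_isolated_eq_Union[OF is_multigraph_\<Gamma>[OF y]]
    by (simp add: image_UN del: \<Gamma>_simps(3))
  moreover have "inj_on ?c (non_isolated ?G)"
  proof (rule inj_onI)
    fix a b assume ab: "a \<in> non_isolated ?G" "b \<in> non_isolated ?G" "?c a = ?c b"
    then have "a \<ge> 1" "b \<ge> 1" by (auto simp: non_isolated_def)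
    then show "a = b" using ab(3) k by auto
  qed
  ultimately have "bij_betw ?c (non_isolated ?G) (non_isolated ?G')"
    by (simp add: bij_betw_def)
  then show ?thesis
    unfolding y_def[symmetric] using ends
    by (intro graph_isoI[of _ _ ?c id] is_multigraph_strip is_multigraph_\<Gamma> x y)
      (simp_all del: \<Gamma>_simps(3))
qed

section \<open>Triangular systems\<close>

text \<open>Among the indices with nonzero coefficient take \<open>j\<close> with \<open>r j\<close>
  minimal: equation \<open>j\<close> reduces to its diagonal term. The rank is integer valued so
  that the number of vertices can serve with either sign.\<close>

lemma triangular_zero:
  fixes M :: "'i \<Rightarrow> 'i \<Rightarrow> real" and r :: "'i \<Rightarrow> int"
  assumes "finite I" and diag: "\<And>i. i \<in> I \<Longrightarrow> M i i \<noteq> 0"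
    and tri: "\<And>i j. i \<in> I \<Longrightarrow> j \<in> I \<Longrightarrow> M i j \<noteq> 0 \<Longrightarrow> i = j \<or> r i < r j"
    and zero: "\<And>j. j \<in> I \<Longrightarrow> (\<Sum>i\<in>I. c i * M i j) = 0" and "i \<in> I"
  shows "c i = 0"
proof (rule ccontr)
  assume "c i \<noteq> 0"
  define J where "J = {i \<in> I. c i \<noteq> 0}"
  have "finite (r ` J)" "r ` J \<noteq> {}"
    using assms(1) \<open>i \<in> I\<close> \<open>c i \<noteq> 0\<close> by (auto simp: J_def)
  then obtain j where j: "j \<in> J" "\<And>i. i \<in> J \<Longrightarrow> r j \<le> r i"
    using Min_in[of "r ` J"] Min_le[of "r ` J"] by (metis (no_types) imageE imageI)
  have "c i * M i j = (if i = j then c j * M j j else 0)" if "i \<in> I" for i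
  proof (rule ccontr)
    assume "c i * M i j \<noteq> (if i = j then c j * M j j else 0)"
    then have "i \<noteq> j" "c i \<noteq> 0" "M i j \<noteq> 0" by (auto split: if_splits)
    then show False
      using tri[OF that, of j] j(1) j(2)[of i] that by (simp add: J_def)
  qed
  then have "(\<Sum>i\<in>I. c i * M i j) = (\<Sum>i\<in>I. if i = j then c j * M j j else 0)"
    by (rule sum.cong[OF refl])
  also have "\<dots> = c j * M j j"
    using assms(1) j(1) by (simp add: J_def)
  finally show False
    using zero[of j] diag[of j] j(1) by (simp add: J_def)
qed

text \<open>For an index \<open>i\<close> of minimal rank, column \<open>i\<close> has only its
  diagonal entry, so equation \<open>i\<close> fixes one coefficient. Moving its contribution to the
  right side leaves a smaller triangular system.\<close>

lemma triangular_solve: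
  fixes M :: "'i \<Rightarrow> 'i \<Rightarrow> real" and r :: "'i \<Rightarrow> int"
  assumes "finite I" and "\<And>i. i \<in> I \<Longrightarrow> M i i \<noteq> 0"
    and "\<And>i j. i \<in> I \<Longrightarrow> j \<in> I \<Longrightarrow> M i j \<noteq> 0 \<Longrightarrow> i = j \<or> r i < r j"
  shows "\<exists>c. \<forall>j\<in>I. (\<Sum>i\<in>I. c i * M i j) = b j"
  using assms
proof (induction "card I" arbitrary: I b)
  case 0
  then show ?case by simp
next
  case (Suc m)
  then have "finite (r ` I)" "r ` I \<noteq> {}" by auto
  then obtain i where i: "i \<in> I" "\<And>j. j \<in> I \<Longrightarrow> r i \<le> r j"
    using Min_in[of "r ` I"] Min_le[of "r ` I"] by (metis (no_types) imageE imageI)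
  define a where "a = b i / M i i"
  have "\<exists>c. \<forall>j\<in>I - {i}. (\<Sum>k\<in>I - {i}. c k * M k j) = b j - a * M i j"
    using Suc.hyps(2) i(1) Suc.prems by (intro Suc.hyps(1)) auto
  then obtain c where c: "\<And>j. j \<in> I - {i} \<Longrightarrow> (\<Sum>k\<in>I - {i}. c k * M k j) = b j - a * M i j"
    by blast
  have split: "(\<Sum>k\<in>I. (c(i := a)) k * M k j) = a * M i j + (\<Sum>k\<in>I - {i}. c k * M k j)" for j
    using i(1) Suc.prems(1) by (simp add: sum.remove)
  have "M k i = 0" if "k \<in> I - {i}" for k
    using Suc.prems(3)[of k i] i(1) i(2)[of k] that by (cases "M k i = 0") auto
  then have "(\<Sum>k\<in>I. (c(i := a)) k * M k i) = b i"
    unfolding split using Suc.prems(2)[OF i(1)] by (simp add: a_def)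
  moreover have "(\<Sum>k\<in>I. (c(i := a)) k * M k j) = b j" if "j \<in> I - {i}" for j
    unfolding split using c[OF that] by simp
  ultimately show ?case by blast
qed

text \<open>Independence of the image set would overlook repeated vectors; the coefficients 1 and -1
  at two equal members rule them out.\<close>

lemma independent_family:
  fixes f :: "'i \<Rightarrow> 'v::real_vector"
  assumes "finite I" and zero: "\<And>c. (\<Sum>i\<in>I. c i *\<^sub>R f i) = 0 \<Longrightarrow> \<forall>i\<in>I. c i = 0"
  shows "inj_on f I \<and> independent (f ` I)"
proof
  show inj: "inj_on f I"
  proof (rule inj_onI, rule ccontr)
    fix i j assume ij: "i \<in> I" "j \<in> I" "f i = f j" "i \<noteq> j"
    define c where "c = (\<lambda>k. if k = i then 1 else if k = j then -1 else (0::real))"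
    have "(\<Sum>k\<in>I. c k *\<^sub>R f k) = (\<Sum>k\<in>{i, j}. c k *\<^sub>R f k)"
      using assms(1) ij by (intro sum.mono_neutral_right) (auto simp: c_def)
    also have "\<dots> = 0" using ij by (simp add: c_def)
    finally show False using zero[of c] ij(1) by (auto simp: c_def)
  qed
  show "independent (f ` I)"
  proof (rule real_vector.independent_if_scalars_zero)
    fix u x assume "(\<Sum>x\<in>f ` I. u x *\<^sub>R x) = 0" "x \<in> f ` I"
    then show "u x = 0"
      using zero[of "u \<circ> f"] inj by (auto simp: sum.reindex)
  qed (use assms(1) in simp)
qed

lemma sum_fun_apply: "(\<Sum>i\<in>I. f i) x = (\<Sum>i\<in>I. f i x)"
  for f :: "'i \<Rightarrow> 'a \<Rightarrow> 'b::comm_monoid_add"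
  by (induction I rule: infinite_finite_induct) auto

section \<open>The surjection matrix\<close>

definition surj_matrix :: "graph_class \<Rightarrow> graph_class \<Rightarrow> real" where
  "surj_matrix C D = real (card (Surj (rep C) (rep D)))"

definition num_verts :: "graph_class \<Rightarrow> nat" where
  "num_verts C = card (verts (rep C))"

lemma repD:
  assumes "C \<in> \<H>\<^sub>n n"
  shows "is_multigraph (rep C)" "card (edges (rep C)) = n" "non_isolated (rep C) = verts (rep C)"
    "C = graph_iso `` {rep C}"
  using \<H>\<^sub>nD[OF assms rep_in[OF assms]] .

lemma \<H>\<^sub>n_eqI:
  assumes "C \<in> \<H>\<^sub>n n" "D \<in> \<H>\<^sub>n n" "Surj (rep C) (rep D) \<noteq> {}" "num_verts C \<le> num_verts D"
  shows "C = D"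
proof -
  have "(rep C, rep D) \<in> graph_iso"
    using repD[OF assms(1)] repD[OF assms(2)] assms(3,4)
    by (intro Surj_imp_graph_iso) (auto simp: num_verts_def)
  then show ?thesis
    using repD[OF assms(1)] repD[OF assms(2)] graph_class_eq_iff by metis
qed

lemma surj_matrix_diag: "C \<in> \<H>\<^sub>n n \<Longrightarrow> surj_matrix C C \<noteq> 0"
  using Surj_refl[OF repD(1)] finite_Surj[OF repD(1) repD(1)] by (simp add: surj_matrix_def)

lemma surj_matrix_triangular:
  assumes "C \<in> \<H>\<^sub>n n" "D \<in> \<H>\<^sub>n n" "surj_matrix C D \<noteq> 0"
  shows "C = D \<or> num_verts D < num_verts C"
proof -
  have "Surj (rep C) (rep D) \<noteq> {}"
    using assms(3) by (auto simp: surj_matrix_def)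
  then show ?thesis
    using \<H>\<^sub>n_eqI[OF assms(1,2)] by (meson not_le)
qed

lemma card_Surj_class:
  assumes "C \<in> \<H>\<^sub>n n" "D \<in> \<H>\<^sub>n n" "G \<in> D"
  shows "real (card (Surj (rep C) G)) = surj_matrix C D"
proof -
  have "(rep D, G) \<in> graph_iso"
    using repD(4)[OF assms(2)] assms(3) by auto
  then show ?thesis
    using card_Surj_cong[OF repD(1)[OF assms(1)]] by (simp add: surj_matrix_def)
qed

lemma strip_\<Gamma>_class:
  assumes "valid_tuple n p x"
  shows "strip_class (graph_iso `` {\<Gamma> n p x}) \<in> \<H>\<^sub>n n"
    "strip (\<Gamma> n p x) \<in> strip_class (graph_iso `` {\<Gamma> n p x})"
    "strip_class (graph_iso `` {\<Gamma> n p x}) = graph_iso `` {strip (\<Gamma> n p x)}"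
  using strip_class_in[OF \<Gamma>_in_\<H>\<^sub>n\<^sub>p[OF assms]] strip_class_graph_iso[OF is_multigraph_\<Gamma>[OF assms]]
    graph_iso_refl[OF is_multigraph_strip[OF is_multigraph_\<Gamma>[OF assms]]]
  by simp_all

lemma T_vec_eq:
  assumes "C \<in> \<H>\<^sub>n n" "h \<in> \<H>\<^sub>n\<^sub>p n p" "p > 0"
  shows "T_vec n p C h = surj_matrix C (strip_class h) / real p ^ num_verts C"
  using assms T_eq_card_Surj[OF repD(1)[OF assms(1)] repD(3)[OF assms(1)] repD(2)[OF assms(1)] assms(3,2),
      of "rep (strip_class h)"] rep_in[OF strip_class_in[OF assms(2)]]
  by (simp add: T_vec_def surj_matrix_def num_verts_def)

lemma T_vec_combination_zero:
  assumes "n \<ge> 1" "p \<ge> 2 * n" and zero: "\<And>h. h \<in> \<H>\<^sub>n\<^sub>p n p \<Longrightarrow> (\<Sum>C\<in>\<H>\<^sub>n n. c C * T_vec n p C h) = 0"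
    and "C \<in> \<H>\<^sub>n n"
  shows "c C = 0"
proof -
  have p: "p > 0" using assms(1,2) by simp
  \<comment> \<open>The powers of \<open>p\<close> are moved into the coefficients, which leaves the
    bare surjection matrix; as \<open>p \<ge> 2 * n\<close>, all its columns occur.\<close>
  have "c C / real p ^ num_verts C = 0"
  proof (rule triangular_zero[OF finite_\<H>\<^sub>n[of n], where M = surj_matrix and r = "\<lambda>C. - int (num_verts C)"
        and c = "\<lambda>C. c C / real p ^ num_verts C"])
    fix D assume "D \<in> \<H>\<^sub>n n"
    then obtain h where h: "h \<in> \<H>\<^sub>n\<^sub>p n p" "strip_class h = D"
      using strip_class_bij_betw[OF assms(2)] by (metis bij_betw_imp_surj_on imageE)
    show "(\<Sum>C\<in>\<H>\<^sub>n n. c C / real p ^ num_verts C * surj_matrix C D) = 0"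
      using zero[OF h(1)] h p by (simp add: T_vec_eq)
  qed (use surj_matrix_diag surj_matrix_triangular assms(4) in auto)
  then show ?thesis using p by simp
qed

section \<open>The refinement counts\<close>

definition refinements_to :: "nat \<Rightarrow> nat \<Rightarrow> nat \<Rightarrow> (nat \<Rightarrow> nat \<times> nat) \<Rightarrow> graph_class \<Rightarrow> (nat \<Rightarrow> nat \<times> nat) set" where
  "refinements_to n k p x h = {ij \<in> refinements n k. strip (\<Gamma> n (k * p) (refine_tuple k x ij)) \<in> h}"

lemma mem_class_iff:
  assumes "h \<in> \<H>\<^sub>n n" "valid_tuple n p x"
  shows "strip (\<Gamma> n p x) \<in> h \<longleftrightarrow> strip_class (graph_iso `` {\<Gamma> n p x}) = h"
  using strip_\<Gamma>_class(2,3)[OF assms(2)] \<H>\<^sub>nD(4)[OF assms(1)] by metis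

text \<open>The counts are determined by the numbers of surjections onto the unrefined multigraph,
  because the surjection matrix is invertible.\<close>

lemma card_refinements_to_cong:
  assumes x: "valid_tuple n p x" and x': "valid_tuple n p' x'" and k: "k \<ge> 1"
    and iso: "(strip (\<Gamma> n p x), strip (\<Gamma> n p' x')) \<in> graph_iso" and "h \<in> \<H>\<^sub>n n"
  shows "card (refinements_to n k p x h) = card (refinements_to n k p' x' h)"
proof -
  let ?cls = "\<lambda>p x ij. strip_class (graph_iso `` {\<Gamma> n (k * p) (refine_tuple k x ij)})"
  \<comment> \<open>Grouping refinements by class gives a linear system for the counts whose right
    side depends on the tuple only through its stripped class.\<close>
  have sum: "(\<Sum>h\<in>\<H>\<^sub>n n. real (card (refinements_to n k p x h)) * surj_matrix D h) =
      real k ^ num_verts D * real (card (Surj (rep D) (strip (\<Gamma> n p x))))"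
    if x: "valid_tuple n p x" and D: "D \<in> \<H>\<^sub>n n" for p x D
  proof -
    have "(\<Sum>h\<in>\<H>\<^sub>n n. real (card (refinements_to n k p x h)) * surj_matrix D h) =
        (\<Sum>h\<in>\<H>\<^sub>n n. \<Sum>ij\<in>{ij \<in> refinements n k. ?cls p x ij = h}. surj_matrix D (?cls p x ij))"
    proof (rule sum.cong)
      fix h assume h: "h \<in> \<H>\<^sub>n n"
      have "refinements_to n k p x h = {ij \<in> refinements n k. ?cls p x ij = h}"
        using mem_class_iff[OF h valid_refine_tuple[OF x]] by (auto simp: refinements_to_def)
      then show "real (card (refinements_to n k p x h)) * surj_matrix D h =
          (\<Sum>ij\<in>{ij \<in> refinements n k. ?cls p x ij = h}. surj_matrix D (?cls p x ij))"
        by simp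
    qed simp
    also have "\<dots> = (\<Sum>ij\<in>refinements n k. surj_matrix D (?cls p x ij))"
      using strip_\<Gamma>_class(1)[OF valid_refine_tuple[OF x]]
      by (intro sum.group finite_refinements finite_\<H>\<^sub>n) auto
    also have "\<dots> = (\<Sum>ij\<in>refinements n k.
        real (card (Surj (rep D) (strip (\<Gamma> n (k * p) (refine_tuple k x ij))))))"
      using card_Surj_class[OF D strip_\<Gamma>_class(1,2)[OF valid_refine_tuple[OF x]]] by simp
    also have "\<dots> = real k ^ num_verts D * real (card (Surj (rep D) (strip (\<Gamma> n p x))))"
      using sum_Surj_refine[OF repD(1)[OF D] repD(3)[OF D] repD(2)[OF D] x k]
      by (simp add: num_verts_def)
    finally show ?thesis .
  qed
  \<comment> \<open>Here the unknowns sit at the targets of surjections, so the transposed matrix is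
    used and the rank changes sign.\<close>
  have "real (card (refinements_to n k p x h)) - real (card (refinements_to n k p' x' h)) = 0"
  proof (rule triangular_zero[OF finite_\<H>\<^sub>n[of n], where M = "\<lambda>C D. surj_matrix D C" and
        r = "\<lambda>C. int (num_verts C)" and
        c = "\<lambda>h. real (card (refinements_to n k p x h)) - real (card (refinements_to n k p' x' h))"])
    fix D assume D: "D \<in> \<H>\<^sub>n n"
    have "card (Surj (rep D) (strip (\<Gamma> n p x))) = card (Surj (rep D) (strip (\<Gamma> n p' x')))"
      using card_Surj_cong[OF repD(1)[OF D] iso] .
    then show "(\<Sum>h\<in>\<H>\<^sub>n n. (real (card (refinements_to n k p x h)) -
        real (card (refinements_to n k p' x' h))) * surj_matrix D h) = 0"
      using sum[OF x D] sum[OF x' D] by (simp add: left_diff_distrib sum_subtractf)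
  qed (use \<open>h \<in> \<H>\<^sub>n n\<close> in \<open>auto dest: surj_matrix_diag surj_matrix_triangular\<close>)
  then show ?thesis by simp
qed

lemma refine_count_eq:
  assumes x: "x \<in> pair_tuples n p" "p \<ge> 2" and k: "k \<ge> 1" and h: "h \<in> \<H>\<^sub>n n"
  shows "refine_count n k (strip_class (graph_iso `` {\<Gamma> n p x})) h = card (refinements_to n k p x h)"
  unfolding refine_count_def
proof (rule the_equality)
  let ?g = "strip_class (graph_iso `` {\<Gamma> n p x})"
  have eq: "{ij \<in> {1..n} \<rightarrow>\<^sub>E {1..k} \<times> {1..k}.
      strip (\<Gamma> n (k * p) (\<lambda>l. refine k (x l) (ij l))) \<in> h} = refinements_to n k p x h" for p x
    by (simp add: refinements_to_def refinements_def refine_tuple_def)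
  note vx = valid_pair_tuples[OF x(1)]
  show "\<forall>q\<ge>2. \<forall>y\<in>pair_tuples n q. strip (\<Gamma> n q y) \<in> ?g \<longrightarrow> card (refinements_to n k p x h) =
      card {ij \<in> {1..n} \<rightarrow>\<^sub>E {1..k} \<times> {1..k}. strip (\<Gamma> n (k * q) (\<lambda>l. refine k (y l) (ij l))) \<in> h}"
    unfolding eq
  proof (intro allI ballI impI)
    fix q y assume "q \<ge> 2" "y \<in> pair_tuples n q" "strip (\<Gamma> n q y) \<in> ?g"
    then show "card (refinements_to n k p x h) = card (refinements_to n k q y h)"
      using strip_\<Gamma>_class(3)[OF vx] by (intro card_refinements_to_cong[OF vx valid_pair_tuples k _ h]) auto
  qed
  \<comment> \<open>Uniqueness holds because \<open>x\<close> itself is among the tuples over which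
    the condition ranges.\<close>
  show "c = card (refinements_to n k p x h)"
    if "\<forall>q\<ge>2. \<forall>y\<in>pair_tuples n q. strip (\<Gamma> n q y) \<in> ?g \<longrightarrow> c =
      card {ij \<in> {1..n} \<rightarrow>\<^sub>E {1..k} \<times> {1..k}. strip (\<Gamma> n (k * q) (\<lambda>l. refine k (y l) (ij l))) \<in> h}" for c
    using that x strip_\<Gamma>_class(2)[OF vx] unfolding eq by blast
qed

text \<open>At a fixed number of vertices the stripped class determines the class, so each
  refinement contributes to exactly one summand. Consistency thus becomes a statement about tuples
  without the matrix.\<close>

lemma sum_refine_count:
  fixes B :: "graph_class \<Rightarrow> real"
  assumes x: "x \<in> pair_tuples n p" "p \<ge> 2" and k: "k \<ge> 1"
  shows "(\<Sum>h\<in>\<H>\<^sub>n\<^sub>p n (k * p). real (refine_count n k (strip_class (graph_iso `` {\<Gamma> n p x})) (strip_class h)) * B h) =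
    (\<Sum>ij\<in>refinements n k. B (graph_iso `` {\<Gamma> n (k * p) (refine_tuple k x ij)}))"
proof -
  let ?cls = "\<lambda>ij. graph_iso `` {\<Gamma> n (k * p) (refine_tuple k x ij)}"
  note valid = valid_refine_tuple[OF valid_pair_tuples[OF x(1)]]
  have "(\<Sum>h\<in>\<H>\<^sub>n\<^sub>p n (k * p). real (refine_count n k (strip_class (graph_iso `` {\<Gamma> n p x})) (strip_class h)) * B h) =
      (\<Sum>h\<in>\<H>\<^sub>n\<^sub>p n (k * p). \<Sum>ij\<in>{ij \<in> refinements n k. ?cls ij = h}. B (?cls ij))"
  proof (rule sum.cong)
    fix h assume h: "h \<in> \<H>\<^sub>n\<^sub>p n (k * p)"
    have "strip_class (?cls ij) = strip_class h \<longleftrightarrow> ?cls ij = h" if "ij \<in> refinements n k" for ij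
      using inj_on_strip_class h \<Gamma>_in_\<H>\<^sub>n\<^sub>p[OF valid[OF that]] by (auto dest: inj_onD)
    then have "refinements_to n k p x (strip_class h) = {ij \<in> refinements n k. ?cls ij = h}"
      using mem_class_iff[OF strip_class_in[OF h] valid] by (auto simp: refinements_to_def)
    then show "real (refine_count n k (strip_class (graph_iso `` {\<Gamma> n p x})) (strip_class h)) * B h =
        (\<Sum>ij\<in>{ij \<in> refinements n k. ?cls ij = h}. B (?cls ij))"
      using refine_count_eq[OF x k strip_class_in[OF h]] by simp
  qed simp
  also have "\<dots> = (\<Sum>ij\<in>refinements n k. B (?cls ij))"
    using \<Gamma>_in_\<H>\<^sub>n\<^sub>p[OF valid] by (intro sum.group finite_refinements finite_\<H>\<^sub>n\<^sub>p) auto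
  finally show ?thesis .
qed

section \<open>Linearly consistent vectors\<close>

lemma LC_iff:
  "A \<in> LC n \<longleftrightarrow> A \<in> prod_X n \<and> (\<forall>p\<ge>2. \<forall>k\<ge>1. \<forall>x\<in>pair_tuples n p. A p (graph_iso `` {\<Gamma> n p x}) =
     (\<Sum>ij\<in>refinements n k. A (k * p) (graph_iso `` {\<Gamma> n (k * p) (refine_tuple k x ij)})))"
proof -
  have "(\<forall>g\<in>\<H>\<^sub>n\<^sub>p n p. A p g = (\<Sum>h\<in>\<H>\<^sub>n\<^sub>p n (k * p).
        real (refine_count n k (strip_class g) (strip_class h)) * A (k * p) h)) \<longleftrightarrow>
      (\<forall>x\<in>pair_tuples n p. A p (graph_iso `` {\<Gamma> n p x}) =
        (\<Sum>ij\<in>refinements n k. A (k * p) (graph_iso `` {\<Gamma> n (k * p) (refine_tuple k x ij)})))"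
    (is "(\<forall>g\<in>_. ?P g) \<longleftrightarrow> (\<forall>x\<in>_. ?Q x)") if pk: "p \<ge> 2" "k \<ge> 1" for p k
  proof -
    have PQ: "?P (graph_iso `` {\<Gamma> n p x}) \<longleftrightarrow> ?Q x" if "x \<in> pair_tuples n p" for x
      by (simp only: sum_refine_count[OF that pk])
    show ?thesis
    proof (intro iffI ballI)
      fix x assume "\<forall>g\<in>\<H>\<^sub>n\<^sub>p n p. ?P g" "x \<in> pair_tuples n p"
      then show "?Q x" using PQ \<Gamma>_in_\<H>\<^sub>n\<^sub>p valid_pair_tuples by blast
    next
      fix g assume *: "\<forall>x\<in>pair_tuples n p. ?Q x" "g \<in> \<H>\<^sub>n\<^sub>p n p"
      from *(2) obtain x where x: "x \<in> pair_tuples n p" "g = graph_iso `` {\<Gamma> n p x}"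
        by (rule ex_\<Gamma>)
      from *(1) x(1) have "?Q x" by (rule bspec)
      then show "?P g" using PQ[OF x(1)] x(2) by metis
    qed
  qed
  then show ?thesis unfolding LC_def by auto
qed

text \<open>The factor k^|V(H)| from \<open>sum_Surj_refine\<close> cancels against the
  normalisation (k p)^|V(H)|.\<close>

lemma T_family_in_LC:
  assumes C: "C \<in> \<H>\<^sub>n n" shows "T_family n C \<in> LC n"
  unfolding LC_iff
proof (intro conjI allI impI ballI)
  show "T_family n C \<in> prod_X n"
    by (auto simp: prod_X_def T_family_def T_vec_def)
  have eq: "T_family n C p (graph_iso `` {\<Gamma> n p x}) =
      real (card (Surj (rep C) (strip (\<Gamma> n p x)))) / real p ^ num_verts C"
    if "valid_tuple n p x" "p \<ge> 2" for p x
    using T_vec_eq[OF C \<Gamma>_in_\<H>\<^sub>n\<^sub>p[OF that(1)]] card_Surj_class[OF C strip_\<Gamma>_class(1,2)[OF that(1)]] that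
    by (simp add: T_family_def)
  fix p k :: nat and x assume pk: "p \<ge> 2" "k \<ge> 1" and x: "x \<in> pair_tuples n p"
  note vx = valid_pair_tuples[OF x]
  have kp: "k * p \<ge> 2" using pk mult_le_mono[of 1 k 2 p] by simp
  have "(\<Sum>ij\<in>refinements n k. T_family n C (k * p) (graph_iso `` {\<Gamma> n (k * p) (refine_tuple k x ij)})) =
      (\<Sum>ij\<in>refinements n k. real (card (Surj (rep C) (strip (\<Gamma> n (k * p) (refine_tuple k x ij)))))) /
        real (k * p) ^ num_verts C"
    using eq[OF valid_refine_tuple[OF vx] kp] by (simp add: sum_divide_distrib)
  also have "\<dots> = real (card (Surj (rep C) (strip (\<Gamma> n p x)))) / real p ^ num_verts C"
    using sum_Surj_refine[OF repD(1)[OF C] repD(3)[OF C] repD(2)[OF C] vx pk(2)] pk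
    by (simp add: num_verts_def power_mult_distrib)
  finally show "T_family n C p (graph_iso `` {\<Gamma> n p x}) = (\<Sum>ij\<in>refinements n k.
      T_family n C (k * p) (graph_iso `` {\<Gamma> n (k * p) (refine_tuple k x ij)}))"
    using eq[OF vx pk(1)] by simp
qed

lemma subspace_LC: "subspace (LC n)"
proof (rule subspaceI)
  show "0 \<in> LC n" by (simp add: LC_iff prod_X_def)
  show "A + B \<in> LC n" if "A \<in> LC n" "B \<in> LC n" for A B
    using that by (simp add: LC_iff prod_X_def sum.distrib)
  show "c *\<^sub>R A \<in> LC n" if "A \<in> LC n" for c A
    using that by (simp add: LC_iff prod_X_def scaleR_fun_def sum_distrib_left)
qed

text \<open>A refinement either increases the number of non-isolated vertices or leaves the
  isomorphism class of the stripped multigraph unchanged, and the latter does occur. So a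
  vector at level \<open>k * p\<close> whose consistency sums vanish must vanish on classes with the
  most non-isolated vertices.\<close>

lemma LC_vanish_refine:
  assumes B: "B \<in> LC n" and p: "p \<ge> 2" "p \<ge> 2 * n" and zero: "\<And>h. h \<in> \<H>\<^sub>n\<^sub>p n p \<Longrightarrow> B p h = 0"
    and k: "k \<ge> 1" and "h \<in> \<H>\<^sub>n\<^sub>p n (k * p)"
  shows "B (k * p) h = 0"
proof (rule ccontr)
  assume "B (k * p) h \<noteq> 0"
  let ?r = "\<lambda>h. num_verts (strip_class h)"
  define J where "J = {h \<in> \<H>\<^sub>n\<^sub>p n (k * p). B (k * p) h \<noteq> 0}"
  have "finite (?r ` J)" "?r ` J \<noteq> {}"
    using finite_\<H>\<^sub>n\<^sub>p \<open>h \<in> _\<close> \<open>B (k * p) h \<noteq> 0\<close> by (auto simp: J_def)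
  then obtain m where "m \<in> J" "Max (?r ` J) = ?r m"
    using Max_in[of "?r ` J"] by blast
  then have m: "m \<in> J" "\<And>h. h \<in> J \<Longrightarrow> ?r h \<le> ?r m"
    using Max_ge[OF \<open>finite (?r ` J)\<close>] by force+
  have mH: "m \<in> \<H>\<^sub>n\<^sub>p n (k * p)" using m(1) by (simp add: J_def)
  \<comment> \<open>As \<open>p \<ge> 2 * n\<close>, the stripped class of \<open>m\<close> already
    occurs at level \<open>p\<close>; the consistency equation of that \<open>g\<close> isolates
    \<open>m\<close>.\<close>
  have "strip_class m \<in> strip_class ` \<H>\<^sub>n\<^sub>p n p"
    using strip_class_in[OF mH] strip_class_bij_betw[OF p(2)] by (simp add: bij_betw_def)
  then obtain g where g: "g \<in> \<H>\<^sub>n\<^sub>p n p" "strip_class g = strip_class m" by force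
  obtain x where x: "x \<in> pair_tuples n p" "g = graph_iso `` {\<Gamma> n p x}"
    using g(1) by (rule ex_\<Gamma>)
  note vx = valid_pair_tuples[OF x(1)]
  let ?cls = "\<lambda>ij. graph_iso `` {\<Gamma> n (k * p) (refine_tuple k x ij)}"
  \<comment> \<open>A refinement with nonzero value has, by maximality of \<open>m\<close>, no more
    non-isolated vertices than \<open>g\<close>; its collapse onto the coarse multigraph is then an
    isomorphism, and its class is \<open>m\<close>.\<close>
  have term_eq: "B (k * p) (?cls ij) = (if ?cls ij = m then B (k * p) m else 0)"
    if ij: "ij \<in> refinements n k" for ij
  proof -
    let ?D = "strip_class (?cls ij)"
    note vy = valid_refine_tuple[OF vx ij]
    have D: "?D \<in> \<H>\<^sub>n n" "?cls ij \<in> \<H>\<^sub>n\<^sub>p n (k * p)"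
      using strip_\<Gamma>_class(1)[OF vy] \<Gamma>_in_\<H>\<^sub>n\<^sub>p[OF vy] by simp_all
    have "?cls ij = m" if "?cls ij \<in> J"
    proof -
      have Dy: "card (edges (strip (\<Gamma> n (k * p) (refine_tuple k x ij)))) = n"
        "is_multigraph (strip (\<Gamma> n (k * p) (refine_tuple k x ij)))"
        using is_multigraph_strip[OF is_multigraph_\<Gamma>[OF vy]] by simp_all
      have Dx: "card (edges (strip (\<Gamma> n p x))) = n" "is_multigraph (strip (\<Gamma> n p x))"
        using is_multigraph_strip[OF is_multigraph_\<Gamma>[OF vx]] by simp_all
      have isoy: "(rep ?D, strip (\<Gamma> n (k * p) (refine_tuple k x ij))) \<in> graph_iso"
        using repD(4)[OF D(1)] strip_\<Gamma>_class(2)[OF vy] by auto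
      have isox: "(rep (strip_class g), strip (\<Gamma> n p x)) \<in> graph_iso"
        using repD(4)[OF strip_class_in[OF g(1)]] strip_\<Gamma>_class(2)[OF vx] x(2) by auto
      have "num_verts ?D \<le> num_verts (strip_class g)"
        using m(2)[OF that] g(2) by simp
      then have "card (verts (strip (\<Gamma> n (k * p) (refine_tuple k x ij)))) \<le> card (verts (strip (\<Gamma> n p x)))"
        using graph_iso_card(1)[OF isoy] graph_iso_card(1)[OF isox] by (simp add: num_verts_def)
      then have "(strip (\<Gamma> n (k * p) (refine_tuple k x ij)), strip (\<Gamma> n p x)) \<in> graph_iso"
        using Dx Dy by (intro Surj_imp_graph_iso[OF Dy(2) Dx(2)] Surj_refine_tuple[OF vx ij]) simp_all
      then have "?D = strip_class g"
        using strip_\<Gamma>_class(3)[OF vy] strip_\<Gamma>_class(3)[OF vx] x(2) graph_class_eq_iff[OF Dy(2) Dx(2)]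
        by metis
      then show ?thesis
        using inj_onD[OF inj_on_strip_class] g(2) D(2) mH by metis
    qed
    then show ?thesis using D(2) by (auto simp: J_def)
  qed
  define I where "I = {ij \<in> refinements n k. ?cls ij = m}"
  have "0 = (\<Sum>ij\<in>refinements n k. B (k * p) (?cls ij))"
    using B p(1) k x zero[OF g(1)] unfolding LC_iff by metis
  also have "\<dots> = (\<Sum>ij\<in>refinements n k. if ?cls ij = m then B (k * p) m else 0)"
    using term_eq by (rule sum.cong[OF refl])
  also have "\<dots> = real (card I) * B (k * p) m"
    unfolding I_def by (simp add: sum.inter_filter[symmetric] finite_refinements)
  finally have "card I = 0"
    using m(1) by (simp add: J_def)
  moreover have "finite I" by (simp add: I_def finite_refinements)
  moreover have "(\<lambda>l\<in>{1..n}. (1, 1)) \<in> I"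
  proof -
    let ?ij = "\<lambda>l\<in>{1..n}. (1::nat, 1::nat)"
    have ij: "?ij \<in> refinements n k" using k by (auto simp: refinements_def)
    note vy = valid_refine_tuple[OF vx ij]
    have "strip_class g = strip_class (?cls ?ij)"
      using graph_iso_refine_tuple_const[OF vx k] strip_\<Gamma>_class(3)[OF vy] strip_\<Gamma>_class(3)[OF vx] x(2)
        graph_class_eq_iff[OF is_multigraph_strip[OF is_multigraph_\<Gamma>[OF vx]]
          is_multigraph_strip[OF is_multigraph_\<Gamma>[OF vy]]] by metis
    then have "?cls ?ij = m"
      using inj_onD[OF inj_on_strip_class] g(2) \<Gamma>_in_\<H>\<^sub>n\<^sub>p[OF vy] mH by metis
    then show ?thesis using ij by (simp add: I_def)
  qed
  ultimately show False by auto
qed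

text \<open>Vanishing passes from level \<open>2 * n\<close> to its refinement
  \<open>2 * n * p\<close>. This is also a refinement of level \<open>p\<close>, where consistency
  writes each value as a sum of zeros.\<close>

lemma LC_vanish:
  assumes B: "B \<in> LC n" and n: "n \<ge> 1" and zero: "\<And>h. h \<in> \<H>\<^sub>n\<^sub>p n (2 * n) \<Longrightarrow> B (2 * n) h = 0"
  shows "B = 0"
proof (intro ext)
  fix p h
  show "B p h = 0 p h"
  proof (cases "p \<ge> 2 \<and> h \<in> \<H>\<^sub>n\<^sub>p n p")
    case False
    then show ?thesis using B by (auto simp: LC_iff prod_X_def)
  next
    case True
    then obtain x where x: "x \<in> pair_tuples n p" "h = graph_iso `` {\<Gamma> n p x}"
      using ex_\<Gamma> by metis
    have "B (p * (2 * n)) h' = 0" if "h' \<in> \<H>\<^sub>n\<^sub>p n (p * (2 * n))" for h'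
      using n True zero that by (intro LC_vanish_refine[OF B, of "2 * n" p]) auto
    then have "B (2 * n * p) (graph_iso `` {\<Gamma> n (2 * n * p) (refine_tuple (2 * n) x ij)}) = 0"
      if "ij \<in> refinements n (2 * n)" for ij
      using \<Gamma>_in_\<H>\<^sub>n\<^sub>p[OF valid_refine_tuple[OF valid_pair_tuples[OF x(1)] that]] by (simp add: mult.commute)
    moreover have "B p h = (\<Sum>ij\<in>refinements n (2 * n).
        B (2 * n * p) (graph_iso `` {\<Gamma> n (2 * n * p) (refine_tuple (2 * n) x ij)}))"
    proof -
      have "\<And>p k x. p \<ge> 2 \<Longrightarrow> k \<ge> 1 \<Longrightarrow> x \<in> pair_tuples n p \<Longrightarrow> B p (graph_iso `` {\<Gamma> n p x}) =
          (\<Sum>ij\<in>refinements n k. B (k * p) (graph_iso `` {\<Gamma> n (k * p) (refine_tuple k x ij)}))"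
        using B unfolding LC_iff by blast
      from this[of p "2 * n" x] show ?thesis
        using x True n by simp
    qed
    ultimately show ?thesis by simp
  qed
qed

lemma LC_subset_span:
  assumes "n \<ge> 1" shows "LC n \<subseteq> span (T_family n ` \<H>\<^sub>n n)"
proof
  fix A assume A: "A \<in> LC n"
  let ?p = "2 * n"
  \<comment> \<open>This transports the component at level \<open>2 * n\<close> to the index set of
    the surjection matrix.\<close>
  let ?h = "inv_into (\<H>\<^sub>n\<^sub>p n ?p) strip_class"
  obtain c where c: "\<And>D. D \<in> \<H>\<^sub>n n \<Longrightarrow> (\<Sum>C\<in>\<H>\<^sub>n n. c C * surj_matrix C D) = A ?p (?h D)"
    using triangular_solve[OF finite_\<H>\<^sub>n[of n], of surj_matrix "\<lambda>C. - int (num_verts C)" "\<lambda>D. A ?p (?h D)"]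
      surj_matrix_diag[of _ n] surj_matrix_triangular[of _ n] by fastforce
  \<comment> \<open>The powers of \<open>2 * n\<close> cancel the denominators in
    \<open>T_vec_eq\<close>, so that \<open>S\<close> and \<open>A\<close> agree at level
    \<open>2 * n\<close>.\<close>
  define S where "S = (\<Sum>C\<in>\<H>\<^sub>n n. (c C * real ?p ^ num_verts C) *\<^sub>R T_family n C)"
  have S: "S \<in> span (T_family n ` \<H>\<^sub>n n)"
    unfolding S_def by (intro span_sum span_scale span_base) simp
  have "S \<in> LC n"
    unfolding S_def using subspace_LC T_family_in_LC by (intro subspace_sum subspace_scale) auto
  then have "A - S \<in> LC n"
    using subspace_diff[OF subspace_LC A] by simp
  then have "A - S = 0"
  proof (rule LC_vanish[OF _ assms])
    fix h assume h: "h \<in> \<H>\<^sub>n\<^sub>p n ?p"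
    have "S ?p h = (\<Sum>C\<in>\<H>\<^sub>n n. c C * real ?p ^ num_verts C * T_vec n ?p C h)"
      using assms by (simp add: S_def sum_fun_apply scaleR_fun_def T_family_def)
    also have "\<dots> = (\<Sum>C\<in>\<H>\<^sub>n n. c C * surj_matrix C (strip_class h))"
      using assms by (intro sum.cong) (simp_all add: T_vec_eq[OF _ h])
    also have "\<dots> = A ?p h"
      using c[OF strip_class_in[OF h]] inv_into_f_f[OF inj_on_strip_class h] by simp
    finally show "(A - S) ?p h = 0" by simp
  qed
  then show "A \<in> span (T_family n ` \<H>\<^sub>n n)" using S by simp
qed

theorem theorem3p21:
  shows
    "(\<forall>n\<ge>1. \<forall>p\<ge>2. \<forall>C\<in>\<H>. \<forall>H\<in>C. \<forall>h\<in>\<H>\<^sub>n\<^sub>p n p.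
        card (edges H) \<noteq> n \<longrightarrow> T n p (hom_density H) h = 0) \<and>
     (\<forall>n\<ge>1. \<forall>p\<ge>2. \<forall>C\<in>\<H>\<^sub>n n. \<forall>H\<in>C. \<forall>h\<in>\<H>\<^sub>n\<^sub>p n p. \<forall>G\<in>strip_class h.
        T n p (hom_density H) h = real (card (Surj H G)) / real p ^ card (verts H) \<and>
        (T n p (hom_density H) h > 0 \<longleftrightarrow> Surj H G \<noteq> {})) \<and>
     (\<forall>n\<ge>1. \<forall>p\<ge>2 * n.
        inj_on (T_vec n p) (\<H>\<^sub>n n) \<and> independent (T_vec n p ` \<H>\<^sub>n n)) \<and>
     (\<forall>n\<ge>1. inj_on (T_family n) (\<H>\<^sub>n n) \<and> independent (T_family n ` \<H>\<^sub>n n) \<and>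
        span (T_family n ` \<H>\<^sub>n n) = LC n)"
proof (intro conjI allI impI ballI)
  fix n p :: nat and C H h
  assume "n \<ge> 1" "p \<ge> 2" "C \<in> \<H>" "H \<in> C" "h \<in> \<H>\<^sub>n\<^sub>p n p" "card (edges H) \<noteq> n"
  moreover from this obtain m where "C \<in> \<H>\<^sub>n m" by (auto simp: \<H>_def)
  ultimately show "T n p (hom_density H) h = 0"
    using \<H>\<^sub>nD by (intro T_eq_0) auto
next
  fix n p :: nat and C H h G
  assume *: "n \<ge> 1" "p \<ge> 2" "C \<in> \<H>\<^sub>n n" "H \<in> C" "h \<in> \<H>\<^sub>n\<^sub>p n p" "G \<in> strip_class h"
  note H = \<H>\<^sub>nD[OF *(3,4)]
  show eq: "T n p (hom_density H) h = real (card (Surj H G)) / real p ^ card (verts H)"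
    using * H by (intro T_eq_card_Surj) auto
  have "finite (Surj H G)"
    using finite_Surj[OF H(1) \<H>\<^sub>nD(1)[OF strip_class_in[OF *(5)] *(6)]] .
  then show "T n p (hom_density H) h > 0 \<longleftrightarrow> Surj H G \<noteq> {}"
    unfolding eq using *(2) by (auto simp: zero_less_divide_iff card_gt_0_iff)
next
  fix n p :: nat assume n: "n \<ge> 1" "p \<ge> 2 * n"
  have "inj_on (T_vec n p) (\<H>\<^sub>n n) \<and> independent (T_vec n p ` \<H>\<^sub>n n)"
  proof (rule independent_family[OF finite_\<H>\<^sub>n])
    fix c assume zero: "(\<Sum>C\<in>\<H>\<^sub>n n. c C *\<^sub>R T_vec n p C) = 0"
    show "\<forall>C\<in>\<H>\<^sub>n n. c C = 0"
    proof (rule ballI, rule T_vec_combination_zero[OF n])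
      show "(\<Sum>C\<in>\<H>\<^sub>n n. c C * T_vec n p C h) = 0" for h
        using fun_cong[OF zero, of h] by (simp add: sum_fun_apply scaleR_fun_def)
    qed
  qed
  then show "inj_on (T_vec n p) (\<H>\<^sub>n n)" "independent (T_vec n p ` \<H>\<^sub>n n)"
    by blast+
next
  fix n :: nat assume n: "n \<ge> 1"
  have "inj_on (T_family n) (\<H>\<^sub>n n) \<and> independent (T_family n ` \<H>\<^sub>n n)"
  proof (rule independent_family[OF finite_\<H>\<^sub>n])
    fix c assume zero: "(\<Sum>C\<in>\<H>\<^sub>n n. c C *\<^sub>R T_family n C) = 0"
    \<comment> \<open>Independence is already visible in the component at level
      \<open>2 * n\<close>.\<close>
    show "\<forall>C\<in>\<H>\<^sub>n n. c C = 0"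
    proof (rule ballI, rule T_vec_combination_zero[OF n order_refl])
      show "(\<Sum>C\<in>\<H>\<^sub>n n. c C * T_vec n (2 * n) C h) = 0" for h
        using fun_cong[OF fun_cong[OF zero, of "2 * n"], of h] n
        by (simp add: sum_fun_apply scaleR_fun_def T_family_def)
    qed
  qed
  then show "inj_on (T_family n) (\<H>\<^sub>n n)" "independent (T_family n ` \<H>\<^sub>n n)"
    by blast+
  show "span (T_family n ` \<H>\<^sub>n n) = LC n"
    using LC_subset_span[OF n] span_minimal[OF _ subspace_LC, of "T_family n ` \<H>\<^sub>n n" n] T_family_in_LC
    by blast
qed

end
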